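(* Let $\mathcal F$ be a good cover in $\mathbb R^d$. Then for any $(\mathcal F,r)$-family $\mathcal G$, $$h(\mathcal G)\le r(d+1).$$
   Context: A finite family $\mathcal F$ of compact sets in $\mathbb R^d$ is a good cover if for every subfamily $\mathcal F'\subset\mathcal F$ the intersection $\bigcap\mathcal F'$ is either empty or contractible. A family of sets $\mathcal G$ is an $(\mathcal F,r)$-family if for every finite $\mathcal G'\subset\mathcal G$, the intersection $\bigcap\mathcal G'$ is a union of at most $r$ pairwise disjoint sets belonging to $\mathcal F$. The Helly number $h(\mathcal G)$ of a family $\mathcal G$ is the minimal positive integer $h$ such that whenever a finite subfamily $\mathcal K\subset\mathcal G$ satisfies $\bigcap\mathcal K'\neq\emptyset$ for all $\mathcal K'\subset\mathcal K$ with $|\mathcal K'|\le h$, then $\bigcap\mathcal K\ne\emptyset$. *)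

theory Defs
  imports "HOL-Analysis.Analysis"
begin

definition good_cover :: "'a::euclidean_space set set \<Rightarrow> bool" where
  "good_cover \<F> \<longleftrightarrow> finite \<F> \<and> (\<forall>A\<in>\<F>. compact A) \<and>
     (\<forall>\<F>'\<subseteq>\<F>. \<Inter>\<F>' = {} \<or> contractible (\<Inter>\<F>'))"

definition Fr_family :: "'a set set \<Rightarrow> nat \<Rightarrow> 'a set set \<Rightarrow> bool" where
  "Fr_family \<F> r \<G> \<longleftrightarrow>
     (\<forall>\<G>'. finite \<G>' \<and> \<G>' \<noteq> {} \<and> \<G>' \<subseteq> \<G> \<longrightarrow>
        (\<exists>\<S>. \<S> \<subseteq> \<F> \<and> card \<S> \<le> r \<and> disjoint \<S> \<and> \<Inter>\<G>' = \<Union>\<S>))"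

definition helly_prop :: "'a set set \<Rightarrow> nat \<Rightarrow> bool" where
  "helly_prop \<G> h \<longleftrightarrow>
     (\<forall>\<K>. finite \<K> \<and> \<K> \<subseteq> \<G> \<and>
        (\<forall>\<K>'\<subseteq>\<K>. card \<K>' \<le> h \<longrightarrow> \<Inter>\<K>' \<noteq> {}) \<longrightarrow> \<Inter>\<K> \<noteq> {})"

definition helly_number :: "'a set set \<Rightarrow> nat" where
  "helly_number \<G> = (LEAST h. 0 < h \<and> helly_prop \<G> h)"

end

theory Submission
  imports Defs
begin

text \<open>
Suppose \<open>G\<^sub>0, \<dots>, G\<^sub>n\<close> is a minimal subfamily with empty intersection, and \<open>n \<ge> r (d + 1)\<close>. Consider
probability measures on \<open>\<real>\<^sup>d\<close> with at most \<open>r\<close> atoms. Those supported in a set with at most \<open>r\<close>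
contractible components form a contractible space: contract every component to a point, and then
contract the resulting simplex of measures on these points. As all intersections of proper
subfamilies are sets of this kind, one can construct, face by face, a weakly continuous family of
measures \<open>\<mu>\<^sub>z\<close> indexed by the points \<open>z\<close> of the \<open>n\<close>-simplex, such that \<open>\<mu>\<^sub>z\<close> is supported in \<open>G\<^sub>i\<close> whenever
\<open>z\<^sub>i = 0\<close>. Integrating the normalised distance functions \<open>\<phi>\<^sub>i = d(\<cdot>, G\<^sub>i) / (\<Sum>\<^sub>j d(\<cdot>, G\<^sub>j))\<close> against
\<open>\<mu>\<^sub>z\<close> gives a continuous self-map of the simplex that preserves every face and hence is onto. But the
integrals of Lipschitz functions against measures with \<open>r\<close> atoms depend on only
\<open>r d + r - 1 < n\<close> real parameters in a Lipschitz way, so they cannot fill an \<open>n\<close>-simplex.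
\<close>

section \<open>Face-preserving maps of the simplex\<close>

definition unit_cube :: "nat \<Rightarrow> (nat \<Rightarrow> real) set" where
  "unit_cube n = {t. \<forall>i. 0 \<le> t i \<and> t i \<le> 1 \<and> (n \<le> i \<longrightarrow> t i = 0)}"

lemma tendsto_fun_iff:
  fixes f :: "'c \<Rightarrow> 'i \<Rightarrow> 'b::topological_space"
  shows "(f \<longlongrightarrow> l) F \<longleftrightarrow> (\<forall>i. ((\<lambda>c. f c i) \<longlongrightarrow> l i) F)"
  unfolding limitin_canonical_iff[symmetric] euclidean_product_topology[symmetric]
  by (simp add: limitin_componentwise)

text \<open>Pinning the coordinates from \<open>n\<close> on to 0 makes the cube a product of
  compact sets over all of \<open>nat\<close>, so Tychonoff applies.\<close>

lemma compact_unit_cube: "compact (unit_cube n)"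
proof -
  have "(\<forall>i. 0 \<le> t i \<and> t i \<le> 1 \<and> (n \<le> i \<longrightarrow> t i = 0)) \<longleftrightarrow>
      (\<forall>i. t i \<in> (if i < n then {0..1} else {0}))" for t :: "nat \<Rightarrow> real"
    by (intro all_cong1) (auto simp: not_less)
  then have eq: "unit_cube n = PiE UNIV (\<lambda>i. if i < n then {0..1} else {0})"
    unfolding unit_cube_def PiE_UNIV_domain Pi_def by simp
  have "compactin (product_topology (\<lambda>_. euclidean) UNIV) (unit_cube n)"
    unfolding eq compactin_PiE by simp
  then show ?thesis
    unfolding euclidean_product_topology by simp
qed

text \<open>Kuhn's combinatorial lemma on ever finer grids yields points near which every
  \<open>f i\<close> takes both signs. At a limit of these points, continuity forces all
  \<open>f i\<close> to vanish.\<close>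

theorem poincare_miranda:
  fixes f :: "nat \<Rightarrow> (nat \<Rightarrow> real) \<Rightarrow> real"
  assumes cont: "\<And>i. i < n \<Longrightarrow> continuous_on (unit_cube n) (f i)"
    and le: "\<And>i t. \<lbrakk>i < n; t \<in> unit_cube n; t i = 0\<rbrakk> \<Longrightarrow> f i t \<le> 0"
    and ge: "\<And>i t. \<lbrakk>i < n; t \<in> unit_cube n; t i = 1\<rbrakk> \<Longrightarrow> 0 \<le> f i t"
  shows "\<exists>t\<in>unit_cube n. \<forall>i<n. f i t = 0"
proof -
  \<comment> \<open>Scales the integer grid with coordinates in \<open>{0..Suc p}\<close> to mesh
    \<open>1 / Suc p\<close> in the cube.\<close>
  define g where "g = (\<lambda>p x i. if i < n then real (x i) / real (Suc p) else 0)"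
  have g_in: "g p x \<in> unit_cube n" if "\<forall>i<n. x i \<le> Suc p" for p x
    using that by (auto simp: unit_cube_def g_def divide_le_eq)
  have close: "\<bar>g p x j - g p q j\<bar> \<le> 1 / real (Suc p)"
    if "\<forall>j<n. q j \<le> x j \<and> x j \<le> q j + 1" for p x q j
  proof (cases "j < n")
    case True
    have "real (x j) - real (q j) \<le> 1" "0 \<le> real (x j) - real (q j)"
      using that True by force+
    then have "\<bar>real (x j) - real (q j)\<bar> / real (Suc p) \<le> 1 / real (Suc p)"
      by (intro divide_right_mono) auto
    then show ?thesis
      using True by (simp add: g_def flip: diff_divide_distrib)
  qed (simp add: g_def)
  have "\<exists>T. T \<in> unit_cube n \<and> (\<forall>i<n. \<exists>u\<in>unit_cube n. \<exists>v\<in>unit_cube n.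
      f i u \<le> 0 \<and> 0 \<le> f i v \<and> (\<forall>j. \<bar>u j - T j\<bar> \<le> 1 / real (Suc p) \<and> \<bar>v j - T j\<bar> \<le> 1 / real (Suc p)))" for p
  proof -
    \<comment> \<open>Kuhn's lemma prescribes label 0 where \<open>x i = 0\<close> and label 1 where
      \<open>x i = Suc p\<close>; elsewhere the sign of \<open>f i\<close> decides. By
      \<open>le\<close> and \<open>ge\<close> the label is consistent with the sign on those two
      sides as well.\<close>
    define label where
      "label = (\<lambda>x i. if x i = 0 \<or> (x i \<noteq> Suc p \<and> f i (g p x) \<le> 0) then 0 else (1::nat))"
    obtain q where q: "\<forall>i<n. q i < Suc p" and rs: "\<forall>i<n. \<exists>r s. (\<forall>j<n. q j \<le> r j \<and> r j \<le> q j + 1) \<and>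
        (\<forall>j<n. q j \<le> s j \<and> s j \<le> q j + 1) \<and> label r i \<noteq> label s i"
      by (rule kuhn_lemma[of "Suc p" n label]) (auto simp: label_def)
    have lab: "(label x i = 0 \<longrightarrow> f i (g p x) \<le> 0) \<and> (label x i \<noteq> 0 \<longrightarrow> 0 \<le> f i (g p x))"
      if "i < n" "\<forall>j<n. x j \<le> Suc p" for x i
      using le[OF that(1) g_in[OF that(2)]] ge[OF that(1) g_in[OF that(2)]] that(1)
      by (auto simp: label_def g_def)
    show ?thesis
    proof (intro exI[of _ "g p q"] conjI allI impI)
      show "g p q \<in> unit_cube n" using q by (intro g_in) (auto simp: less_imp_le)
      fix i assume i: "i < n"
      then obtain r s where r: "\<forall>j<n. q j \<le> r j \<and> r j \<le> q j + 1"
        and s: "\<forall>j<n. q j \<le> s j \<and> s j \<le> q j + 1" and ne: "label r i \<noteq> label s i"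
        using rs by blast
      have r': "\<forall>j<n. r j \<le> Suc p" and s': "\<forall>j<n. s j \<le> Suc p"
        using q r s by fastforce+
      show "\<exists>u\<in>unit_cube n. \<exists>v\<in>unit_cube n. f i u \<le> 0 \<and> 0 \<le> f i v \<and>
          (\<forall>j. \<bar>u j - g p q j\<bar> \<le> 1 / real (Suc p) \<and> \<bar>v j - g p q j\<bar> \<le> 1 / real (Suc p))"
      proof (cases "label r i = 0")
        case True
        then have "label s i \<noteq> 0" using ne by simp
        then show ?thesis
          using True lab[OF i r'] lab[OF i s'] close[OF r] close[OF s] g_in[OF r'] g_in[OF s'] by blast
      next
        case False
        then have "label s i = 0" using ne by (auto simp: label_def split: if_splits)
        then show ?thesis
          using False lab[OF i r'] lab[OF i s'] close[OF r] close[OF s] g_in[OF r'] g_in[OF s'] by blast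
      qed
    qed
  qed
  then have "\<exists>T. \<forall>p. T p \<in> unit_cube n \<and> (\<forall>i<n. \<exists>u\<in>unit_cube n. \<exists>v\<in>unit_cube n.
      f i u \<le> 0 \<and> 0 \<le> f i v \<and> (\<forall>j. \<bar>u j - T p j\<bar> \<le> 1 / real (Suc p) \<and> \<bar>v j - T p j\<bar> \<le> 1 / real (Suc p)))"
    by (intro choice allI)
  then obtain T where T: "\<And>p. T p \<in> unit_cube n"
    and ex_uv: "\<And>p i. i < n \<Longrightarrow> \<exists>u\<in>unit_cube n. \<exists>v\<in>unit_cube n. f i u \<le> 0 \<and> 0 \<le> f i v \<and>
      (\<forall>j. \<bar>u j - T p j\<bar> \<le> 1 / real (Suc p) \<and> \<bar>v j - T p j\<bar> \<le> 1 / real (Suc p))"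
    by blast
  obtain t \<rho> where t: "t \<in> unit_cube n" and \<rho>: "strict_mono \<rho>" and lim: "(T \<circ> \<rho>) \<longlonglongrightarrow> t"
    using compact_imp_seq_compact[OF compact_unit_cube] T unfolding seq_compact_def by metis
  have lim0: "(\<lambda>p. 1 / real (Suc (\<rho> p))) \<longlonglongrightarrow> 0"
    using LIMSEQ_subseq_LIMSEQ[OF lim_1_over_n[THEN LIMSEQ_Suc] \<rho>] by (simp add: o_def)
  \<comment> \<open>The witnesses of both signs stay within the mesh size of \<open>T p\<close>, so
    along the subsequence they share its limit \<open>t\<close>.\<close>
  have conv: "(\<lambda>p. w (\<rho> p)) \<longlonglongrightarrow> t" if "\<And>p j. \<bar>w p j - T p j\<bar> \<le> 1 / real (Suc p)" for w
    unfolding tendsto_fun_iff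
  proof
    fix j
    have "(\<lambda>p. w (\<rho> p) j - T (\<rho> p) j) \<longlonglongrightarrow> 0"
      by (rule Lim_null_comparison[OF _ lim0]) (use that in auto)
    from tendsto_add[OF this lim[unfolded tendsto_fun_iff, rule_format, of j]]
    show "(\<lambda>p. w (\<rho> p) j) \<longlonglongrightarrow> t j" by (simp add: o_def)
  qed
  have "f i t = 0" if i: "i < n" for i
  proof (rule antisym)
    have "\<forall>p. \<exists>u. u \<in> unit_cube n \<and> f i u \<le> 0 \<and> (\<forall>j. \<bar>u j - T p j\<bar> \<le> 1 / real (Suc p))"
      using ex_uv[OF i] by blast
    then obtain u where u: "\<forall>p. u p \<in> unit_cube n \<and> f i (u p) \<le> 0 \<and> (\<forall>j. \<bar>u p j - T p j\<bar> \<le> 1 / real (Suc p))"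
      by (rule choice[THEN exE])
    have "(\<lambda>p. f i (u (\<rho> p))) \<longlonglongrightarrow> f i t"
      by (rule continuous_on_tendsto_compose[OF cont[OF i] conv t]) (use u in auto)
    then show "f i t \<le> 0" by (rule LIMSEQ_le_const2) (use u in auto)
    have "\<forall>p. \<exists>u. u \<in> unit_cube n \<and> 0 \<le> f i u \<and> (\<forall>j. \<bar>u j - T p j\<bar> \<le> 1 / real (Suc p))"
      using ex_uv[OF i] by blast
    then obtain v where v: "\<forall>p. v p \<in> unit_cube n \<and> 0 \<le> f i (v p) \<and> (\<forall>j. \<bar>v p j - T p j\<bar> \<le> 1 / real (Suc p))"
      by (rule choice[THEN exE])
    have "(\<lambda>p. f i (v (\<rho> p))) \<longlonglongrightarrow> f i t"
      by (rule continuous_on_tendsto_compose[OF cont[OF i] conv t]) (use v in auto)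
    then show "0 \<le> f i t" by (rule LIMSEQ_le_const) (use v in auto)
  qed
  with t show ?thesis by blast
qed

text \<open>
Points of the simplex are functions on \<^typ>\<open>nat\<close>, with the product topology, because its
dimension depends on \<open>r\<close> and cannot be fixed by a type.
\<close>

definition std_face :: "nat set \<Rightarrow> (nat \<Rightarrow> real) set" where
  "std_face \<sigma> = {z. (\<forall>i. 0 \<le> z i) \<and> (\<forall>i. i \<notin> \<sigma> \<longrightarrow> z i = 0) \<and> sum z \<sigma> = 1}"

text \<open>The product is what remains of a unit stick after \<open>k\<close> breaks, the
  \<open>i\<close>-th of which removes the fraction \<open>t i\<close> of the current rest.\<close>

lemma sum_stick_breaking:
  fixes t :: "nat \<Rightarrow> real"
  shows "(\<Sum>i<k. t i * (\<Prod>j<i. 1 - t j)) = 1 - (\<Prod>j<k. 1 - t j)"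
  by (induction k) (auto simp: algebra_simps)

text \<open>
Stick breaking turns the cube into the simplex in such a way that the side \<open>t\<^sub>i = 0\<close> goes to
\<open>z\<^sub>i = 0\<close> and the side \<open>t\<^sub>i = 1\<close> goes to \<open>z\<^sub>j = 0\<close> for all \<open>j > i\<close>; this makes the
Poincare-Miranda theorem applicable.
\<close>

theorem face_preserving_onto_simplex:
  fixes g :: "nat \<Rightarrow> (nat \<Rightarrow> real) \<Rightarrow> real"
  assumes cont: "\<And>i. i \<le> n \<Longrightarrow> continuous_on (std_face {..n}) (g i)"
    and nonneg: "\<And>i z. \<lbrakk>i \<le> n; z \<in> std_face {..n}\<rbrakk> \<Longrightarrow> 0 \<le> g i z"
    and sum1: "\<And>z. z \<in> std_face {..n} \<Longrightarrow> (\<Sum>i\<le>n. g i z) = 1"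
    and face: "\<And>i z. \<lbrakk>i \<le> n; z \<in> std_face {..n}; z i = 0\<rbrakk> \<Longrightarrow> g i z = 0"
    and w0: "\<And>i. i < n \<Longrightarrow> 0 \<le> w i" and w1: "(\<Sum>i<n. w i) < 1"
  shows "\<exists>z\<in>std_face {..n}. \<forall>i<n. g i z = w i"
proof -
  define c where "c = (\<lambda>(t::nat \<Rightarrow> real) i. if i < n then t i * (\<Prod>j<i. 1 - t j)
      else if i = n then (\<Prod>j<n. 1 - t j) else 0)"
  have c_in: "c t \<in> std_face {..n}" if "t \<in> unit_cube n" for t
  proof -
    have "sum (c t) {..n} = (\<Sum>i<n. t i * (\<Prod>j<i. 1 - t j)) + (\<Prod>j<n. 1 - t j)"
      unfolding lessThan_Suc_atMost[symmetric] by (simp add: c_def)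
    moreover have "0 \<le> c t i" for i
      using that by (auto simp: c_def unit_cube_def intro!: mult_nonneg_nonneg prod_nonneg)
    ultimately show ?thesis
      by (auto simp: std_face_def c_def sum_stick_breaking)
  qed
  have cont_c: "continuous_on (unit_cube n) c"
  proof (rule continuous_on_coordinatewise_then_product)
    have coord: "continuous_on (unit_cube n) (\<lambda>t. t j)" for j
      by (rule continuous_on_subset[OF continuous_on_product_coordinates]) simp
    show "continuous_on (unit_cube n) (\<lambda>t. c t i)" for i
      unfolding c_def by (cases "i < n"; cases "i = n") (auto intro!: continuous_intros coord)
  qed
  \<comment> \<open>\<open>W i\<close> is the mass that the targets \<open>w\<close> leave for the
    coordinates from \<open>i\<close> on. It is positive because the targets sum to less than
    1.\<close>
  define W where "W = (\<lambda>i. 1 - (\<Sum>j<i. w j))"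
  have W_pos: "0 < W i" if "i \<le> n" for i
  proof -
    have "(\<Sum>j<i. w j) \<le> (\<Sum>j<n. w j)"
      using that w0 by (intro sum_mono2) auto
    then show ?thesis using w1 by (simp add: W_def)
  qed
  have w_le_W: "w i \<le> W i" if "i < n" for i
    using W_pos[of "Suc i"] that by (simp add: W_def)
  \<comment> \<open>A zero of \<open>f i\<close> says that \<open>g i\<close> takes the share
    \<open>w i / W i\<close> of the tail sum. On \<open>t i = 0\<close> the value \<open>g i\<close>
    vanishes, and on \<open>t i = 1\<close> it is the whole tail, which gives the two signs.\<close>
  define f where "f = (\<lambda>i t. g i (c t) - w i / W i * (\<Sum>j=i..n. g j (c t)))"
  have "\<exists>t\<in>unit_cube n. \<forall>i<n. f i t = 0"
  proof (rule poincare_miranda)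
    fix i assume i: "i < n"
    have gc: "continuous_on (unit_cube n) (\<lambda>t. g j (c t))" if "j \<le> n" for j
      by (rule continuous_on_compose2[OF cont[OF that] cont_c]) (use c_in in auto)
    show "continuous_on (unit_cube n) (f i)"
      unfolding f_def using i by (intro continuous_intros gc) auto
    fix t assume t: "t \<in> unit_cube n"
    have ratio: "0 \<le> w i / W i" "w i / W i \<le> 1"
      using w0 w_le_W W_pos[of i] i by (auto simp: divide_le_eq_1)
    {
      assume "t i = 0"
      then have "g i (c t) = 0" using i by (intro face c_in t) (auto simp: c_def)
      moreover have "0 \<le> (\<Sum>j=i..n. g j (c t))"
        using nonneg c_in[OF t] by (intro sum_nonneg) auto
      ultimately show "f i t \<le> 0"
        using mult_nonneg_nonneg[OF ratio(1)] unfolding f_def by simp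
    }
    {
      assume ti: "t i = 1"
      have "g j (c t) = 0" if "j \<in> {i..n} - {i}" for j
      proof (intro face c_in t)
        have "(\<Prod>l<j. 1 - t l) = 0" using that ti by (intro prod_zero) auto
        then show "c t j = 0" using that by (auto simp: c_def)
      qed (use that in auto)
      then have "(\<Sum>j=i..n. g j (c t)) = (\<Sum>j\<in>{i}. g j (c t))"
        using i by (intro sum.mono_neutral_right) auto
      then have "f i t = (1 - w i / W i) * g i (c t)" by (simp add: f_def algebra_simps)
      then show "0 \<le> f i t" using ratio nonneg[OF _ c_in[OF t], of i] i by simp
    }
  qed
  then obtain t where t: "t \<in> unit_cube n" and zero: "\<And>i. i < n \<Longrightarrow> f i t = 0" by blast
  \<comment> \<open>Once the earlier coordinates hit their targets, the tail sum equals
    \<open>W i\<close>, and the prescribed share of it is \<open>w i\<close>.\<close>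
  have "g i (c t) = w i" if "i < n" for i
    using that
  proof (induction i rule: less_induct)
    case (less i)
    have "{..n} = {..<i} \<union> {i..n}" using less.prems by auto
    then have "(\<Sum>j<i. g j (c t)) + (\<Sum>j=i..n. g j (c t)) = 1"
      using sum1[OF c_in[OF t]] by (simp add: sum.union_disjoint ivl_disj_int)
    moreover have "(\<Sum>j<i. g j (c t)) = (\<Sum>j<i. w j)"
      using less by (intro sum.cong) auto
    ultimately have "(\<Sum>j=i..n. g j (c t)) = W i" by (simp add: W_def)
    then show ?case using zero[OF less.prems] W_pos[of i] less.prems by (simp add: f_def)
  qed
  then show ?thesis using c_in[OF t] by blast
qed

section \<open>Integrals against few atoms\<close>

text \<open>
Pigeonhole: a grid of \<open>M\<^sup>n\<close> target points is separated, up to a constant factor, at scale \<open>1/M\<close>,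
whereas rounding the \<open>e = (r - 1) + r d\<close> parameters at that scale leaves only \<open>O(M\<^sup>e)\<close>
possibilities, and \<open>e < n\<close>.
\<close>

theorem few_atoms_not_onto:
  fixes \<phi> :: "nat \<Rightarrow> 'a::euclidean_space \<Rightarrow> real" and R r n :: nat
  assumes r: "0 < r" and n: "r * (DIM('a) + 1) \<le> n"
    and lip: "\<And>i x y. \<lbrakk>i < n; x \<in> cball 0 R; y \<in> cball 0 R\<rbrakk> \<Longrightarrow> \<bar>\<phi> i x - \<phi> i y\<bar> \<le> L * dist x y"
    and bd: "\<And>i x. \<lbrakk>i < n; x \<in> cball 0 R\<rbrakk> \<Longrightarrow> \<bar>\<phi> i x\<bar> \<le> 1"
  shows "\<exists>w. (\<forall>i<n. 0 \<le> w i) \<and> (\<Sum>i<n. w i) < 1 \<and>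
    \<not> (\<exists>t x. (\<forall>k<r. 0 \<le> t k \<and> x k \<in> cball 0 R) \<and> (\<Sum>k<r. t k) = 1 \<and>
        (\<forall>i<n. (\<Sum>k<r. t k * \<phi> i (x k)) = w i))"
proof (rule ccontr)
  assume "\<not> ?thesis"
  then have onto: "\<exists>t x. (\<forall>k<r. 0 \<le> t k \<and> x k \<in> cball 0 R) \<and> (\<Sum>k<r. t k) = 1 \<and>
      (\<forall>i<n. (\<Sum>k<r. t k * \<phi> i (x k)) = w i)"
    if "\<forall>i<n. 0 \<le> w i" "(\<Sum>i<n. w i) < 1" for w
    using that by blast
  define L' where "L' = max L 0"
  \<comment> \<open>With parameters rounded at scale \<open>1 / N\<close>, the integrals move by at
    most \<open>(r * r + L' * DIM('a)) / N\<close>; target spacing \<open>S / N\<close> exceeds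
    this.\<close>
  obtain S :: nat where S: "real r * real r + L' * DIM('a) < real S"
    using reals_Archimedean2 by blast
  have S_pos: "0 < S"
  proof -
    have "0 \<le> real r * real r + L' * DIM('a)" by (simp add: L'_def)
    then show ?thesis using S by linarith
  qed
  \<comment> \<open>The last weight is determined by total mass 1, so
    \<open>Suc e = r * (DIM('a) + 1)\<close>: this is the source of the constant in the Helly
    bound.\<close>
  define e where "e = (r - 1) + r * DIM('a)"
  have e: "Suc e \<le> n" using r n by (auto simp: e_def algebra_simps)
  \<comment> \<open>With this \<open>N\<close>, the targets \<open>a i * S / N\<close> with
    \<open>a i < M\<close> sum to less than 1. \<open>C * M\<close> bounds the number of rounded
    values of one parameter, and \<open>M > C ^ e\<close> makes \<open>M ^ Suc e\<close> exceed
    \<open>(C * M) ^ e\<close>.\<close>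
  define C where "C = 2 * (S * Suc n * (R + 1)) + 1"
  define M where "M = C ^ e + 1"
  define N where "N = M * S * Suc n"
  have M_pos: "0 < M" by (simp add: M_def)
  have N_pos: "0 < N" using S_pos by (simp add: N_def M_def)
  define A where "A = PiE {..<n} (\<lambda>_. {..<M})"
  have "\<exists>t x. (\<forall>k<r. 0 \<le> t k \<and> x k \<in> cball 0 R) \<and> (\<Sum>k<r. t k) = 1 \<and>
      (\<forall>i<n. (\<Sum>k<r. t k * \<phi> i (x k)) = real (a i) * S / N)" if "a \<in> A" for a
  proof (rule onto)
    have "real (a i) * S / N \<le> 1 / Suc n" if "i < n" for i
    proof -
      have "a i \<le> M" using \<open>a \<in> A\<close> that by (auto simp: A_def PiE_iff less_imp_le)
      then have "real (a i) * S \<le> real M * S" by (intro mult_right_mono) auto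
      then have "real (a i) * S / N \<le> real M * S / N" by (intro divide_right_mono) auto
      also have "\<dots> = 1 / Suc n"
        using S_pos M_pos unfolding N_def of_nat_mult by simp
      finally show ?thesis .
    qed
    then have "(\<Sum>i<n. real (a i) * S / N) \<le> (\<Sum>i<n. 1 / Suc n)" by (intro sum_mono) auto
    also have "\<dots> < 1" by (simp add: field_simps)
    finally show "(\<Sum>i<n. real (a i) * S / N) < 1" .
  qed auto
  then have "\<forall>a\<in>A. \<exists>p. (\<forall>k<r. 0 \<le> fst p k \<and> snd p k \<in> cball 0 R) \<and> (\<Sum>k<r. fst p k) = 1 \<and>
      (\<forall>i<n. (\<Sum>k<r. fst p k * \<phi> i (snd p k)) = real (a i) * S / N)"
    by simp
  then obtain p where p: "\<forall>a\<in>A. (\<forall>k<r. 0 \<le> fst (p a) k \<and> snd (p a) k \<in> cball 0 R) \<and>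
      (\<Sum>k<r. fst (p a) k) = 1 \<and>
      (\<forall>i<n. (\<Sum>k<r. fst (p a) k * \<phi> i (snd (p a) k)) = real (a i) * S / N)"
    by (rule bchoice[THEN exE])
  define t where "t = (\<lambda>a. fst (p a))"
  define x where "x = (\<lambda>a. snd (p a))"
  have tx: "(\<forall>k<r. 0 \<le> t a k \<and> x a k \<in> cball 0 R) \<and> (\<Sum>k<r. t a k) = 1 \<and>
      (\<forall>i<n. (\<Sum>k<r. t a k * \<phi> i (x a k)) = real (a i) * S / N)" if "a \<in> A" for a
    using p that unfolding t_def x_def by blast
  \<comment> \<open>Index set of the free parameters: all weights but the last, and all coordinates
    of the atoms.\<close>
  define I :: "(nat + nat \<times> 'a) set" where "I = {..<r - 1} <+> ({..<r} \<times> Basis)"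
  have card_I: "card I = e" and fin_I: "finite I"
    by (auto simp: I_def e_def card_Plus card_cartesian_product)
  define B where "B = int (N * (R + 1))"
  define u where "u = (\<lambda>a c. case c of Inl k \<Rightarrow> t a k | Inr (k, b) \<Rightarrow> x a k \<bullet> b)"
  define code where "code = (\<lambda>a. restrict (\<lambda>c. \<lfloor>real N * u a c\<rfloor>) I)"
  have u_bd: "\<bar>u a c\<bar> \<le> R + 1" if a: "a \<in> A" and c: "c \<in> I" for a c
  proof (cases c)
    case (Inl k)
    then have k: "k < r" using c by (auto simp: I_def)
    have "t a k \<le> (\<Sum>k<r. t a k)" using tx[OF a] k by (intro member_le_sum) auto
    then show ?thesis using tx[OF a] k by (simp add: u_def Inl)
  next
    case (Inr kb)
    then obtain k b where kb: "c = Inr (k, b)" "k < r" "b \<in> Basis" using c by (auto simp: I_def)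
    have "\<bar>x a k \<bullet> b\<bar> \<le> norm (x a k)" using kb by (simp add: Basis_le_norm)
    also have "\<dots> \<le> R" using tx[OF a] kb by auto
    finally show ?thesis by (simp add: u_def kb)
  qed
  have code_in: "code ` A \<subseteq> PiE I (\<lambda>_. {- B..B})"
  proof clarify
    fix a assume a: "a \<in> A"
    have "\<lfloor>real N * u a c\<rfloor> \<in> {- B..B}" if c: "c \<in> I" for c
    proof -
      have "\<bar>real N * u a c\<bar> \<le> real N * (R + 1)"
        unfolding abs_mult using u_bd[OF a c] by (intro mult_mono) auto
      then have "real_of_int (- B) \<le> real N * u a c" "real N * u a c \<le> real_of_int B"
        by (auto simp: B_def abs_le_iff algebra_simps)
      then show ?thesis by (auto simp: le_floor_iff floor_le_iff)
    qed
    then show "code a \<in> PiE I (\<lambda>_. {- B..B})" by (auto simp: code_def)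
  qed
  \<comment> \<open>Equal codes put all parameters within \<open>1 / N\<close> of each other; the
    integrals then differ by less than the spacing of the targets, so the targets agree.\<close>
  have "inj_on code A"
  proof (rule inj_onI)
    fix a a' assume a: "a \<in> A" and a': "a' \<in> A" and eq: "code a = code a'"
    have u_close: "\<bar>u a c - u a' c\<bar> \<le> 1 / N" if "c \<in> I" for c
    proof -
      have "\<lfloor>real N * u a c\<rfloor> = \<lfloor>real N * u a' c\<rfloor>"
        using fun_cong[OF eq, of c] that by (simp add: code_def)
      then have "\<bar>real N * u a c - real N * u a' c\<bar> < 1" by linarith
      then have "real N * \<bar>u a c - u a' c\<bar> < 1"
        by (simp add: abs_mult flip: right_diff_distrib)
      then show ?thesis using N_pos by (simp add: field_simps)
    qed
    have t1: "\<bar>t a k - t a' k\<bar> \<le> 1 / N" if "k < r - 1" for k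
      using u_close[of "Inl k"] that by (auto simp: I_def u_def)
    \<comment> \<open>The uncoded last weight is 1 minus the others, so it accumulates their
      errors.\<close>
    have t2: "\<bar>t a k - t a' k\<bar> \<le> r / N" if "k < r" for k
    proof (cases "k < r - 1")
      case True
      have "1 / real N \<le> r / N" using r by (intro divide_right_mono) auto
      then show ?thesis using t1[OF True] by linarith
    next
      case False
      then have k: "k = r - 1" using that by simp
      have "{..<r} = insert (r - 1) {..<r - 1}" using r by auto
      then have "t a k = 1 - (\<Sum>l<r - 1. t a l)" "t a' k = 1 - (\<Sum>l<r - 1. t a' l)"
        using tx[OF a] tx[OF a'] k by auto
      then have "\<bar>t a k - t a' k\<bar> = \<bar>\<Sum>l<r - 1. t a' l - t a l\<bar>"
        by (simp add: sum_subtractf)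
      also have "\<dots> \<le> (\<Sum>l<r - 1. \<bar>t a' l - t a l\<bar>)" by (rule sum_abs)
      also have "\<dots> \<le> (\<Sum>l<r - 1. 1 / N)" using t1 by (intro sum_mono) (simp add: abs_minus_commute)
      also have "\<dots> \<le> r / N" by (simp add: divide_right_mono)
      finally show ?thesis .
    qed
    have x1: "dist (x a k) (x a' k) \<le> DIM('a) / N" if "k < r" for k
    proof -
      have "dist (x a k) (x a' k) \<le> (\<Sum>b\<in>Basis. \<bar>(x a k - x a' k) \<bullet> b\<bar>)"
        unfolding dist_norm by (rule norm_le_l1)
      also have "\<dots> \<le> (\<Sum>b\<in>(Basis::'a set). 1 / N)"
      proof (rule sum_mono)
        fix b :: 'a assume "b \<in> Basis"
        then show "\<bar>(x a k - x a' k) \<bullet> b\<bar> \<le> 1 / N"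
          using u_close[of "Inr (k, b)"] that by (auto simp: I_def u_def inner_diff_left)
      qed
      finally show ?thesis by simp
    qed
    have "a i = a' i" if i: "i < n" for i
    proof -
      have "real (a i) * S / N - real (a' i) * S / N
          = (\<Sum>k<r. t a k * \<phi> i (x a k)) - (\<Sum>k<r. t a' k * \<phi> i (x a' k))"
        using tx[OF a] tx[OF a'] i by simp
      also have "\<dots> = (\<Sum>k<r. (t a k - t a' k) * \<phi> i (x a k) + t a' k * (\<phi> i (x a k) - \<phi> i (x a' k)))"
        by (simp add: algebra_simps flip: sum_subtractf)
      finally have "\<bar>real (a i) * S / N - real (a' i) * S / N\<bar>
          \<le> (\<Sum>k<r. \<bar>(t a k - t a' k) * \<phi> i (x a k) + t a' k * (\<phi> i (x a k) - \<phi> i (x a' k))\<bar>)"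
        by (simp add: sum_abs)
      also have "\<dots> \<le> (\<Sum>k<r. r / N * 1 + t a' k * (L' * (DIM('a) / N)))"
      proof (rule sum_mono)
        fix k assume "k \<in> {..<r}"
        then have k: "k < r" by simp
        have xk: "x a k \<in> cball 0 R" "x a' k \<in> cball 0 R" "0 \<le> t a' k"
          using tx[OF a] tx[OF a'] k by auto
        have "\<bar>\<phi> i (x a k) - \<phi> i (x a' k)\<bar> \<le> L * dist (x a k) (x a' k)"
          by (rule lip[OF i xk(1,2)])
        also have "\<dots> \<le> L' * dist (x a k) (x a' k)"
          by (intro mult_right_mono) (auto simp: L'_def)
        also have "\<dots> \<le> L' * (DIM('a) / N)"
          using x1[OF k] by (intro mult_left_mono) (auto simp: L'_def)
        finally have "t a' k * \<bar>\<phi> i (x a k) - \<phi> i (x a' k)\<bar> \<le> t a' k * (L' * (DIM('a) / N))"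
          using xk by (intro mult_left_mono)
        moreover have "\<bar>t a k - t a' k\<bar> * \<bar>\<phi> i (x a k)\<bar> \<le> r / N * 1"
          using t2[OF k] bd[OF i xk(1)] by (intro mult_mono) auto
        ultimately show "\<bar>(t a k - t a' k) * \<phi> i (x a k) + t a' k * (\<phi> i (x a k) - \<phi> i (x a' k))\<bar>
            \<le> r / N * 1 + t a' k * (L' * (DIM('a) / N))"
          using xk(3) by (intro order_trans[OF abs_triangle_ineq]) (simp add: abs_mult)
      qed
      also have "\<dots> = (real r * real r + L' * DIM('a)) / N"
        using tx[OF a'] unfolding sum.distrib sum_distrib_right[symmetric]
        by (simp add: add_divide_distrib)
      also have "\<dots> < S / N"
        using S N_pos by (intro divide_strict_right_mono) auto
      finally have "\<bar>real (a i) * S - real (a' i) * S\<bar> / N < S / N"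
        by (simp add: abs_divide flip: diff_divide_distrib)
      then have "\<bar>real (a i) * S - real (a' i) * S\<bar> < S"
        using N_pos by (simp add: divide_less_cancel)
      then have "\<bar>real (a i) - real (a' i)\<bar> * real S < 1 * real S"
        by (simp add: abs_mult flip: left_diff_distrib)
      then have "\<bar>real (a i) - real (a' i)\<bar> < 1"
        using S_pos by simp
      then show ?thesis by linarith
    qed
    then show "a = a'" using a a' unfolding A_def by (intro PiE_ext) auto
  qed
  \<comment> \<open>There are \<open>M ^ n\<close> targets and at most \<open>(C * M) ^ e\<close>
    codes, which is impossible since \<open>Suc e \<le> n\<close> and
    \<open>M > C ^ e\<close>.\<close>
  then have "card A \<le> card (PiE I (\<lambda>_. {- B..B}))"
    using code_in fin_I by (intro card_inj_on_le) (auto intro!: finite_PiE)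
  then have "M ^ n \<le> nat (2 * B + 1) ^ e"
    using fin_I by (simp add: A_def card_PiE card_I)
  also have "nat (2 * B + 1) = 2 * (N * (R + 1)) + 1"
    by (simp add: B_def nat_add_distrib nat_mult_distrib)
  also have "(2 * (N * (R + 1)) + 1) ^ e \<le> (C * M) ^ e"
    by (intro power_mono) (auto simp: C_def N_def M_def algebra_simps)
  finally have "M ^ n \<le> C ^ e * M ^ e" by (simp add: power_mult_distrib)
  moreover have "M ^ Suc e \<le> M ^ n" using e by (intro power_increasing) (auto simp: M_def)
  ultimately have "M * M ^ e \<le> C ^ e * M ^ e" unfolding power_Suc by linarith
  then have "M \<le> C ^ e" using M_pos by simp
  then show False by (simp add: M_def)
qed

text \<open>
The probability measures with at most \<open>r\<close> atoms in \<open>D\<close>, represented by their integration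
functionals; weak continuity of a family is then pointwise continuity of functionals.
\<close>

definition atomic :: "nat \<Rightarrow> 'a set \<Rightarrow> (('a \<Rightarrow> real) \<Rightarrow> real) \<Rightarrow> bool" where
  "atomic r D \<mu> \<longleftrightarrow> (\<exists>A t. finite A \<and> card A \<le> r \<and> A \<subseteq> D \<and> (\<forall>x\<in>A. 0 \<le> t x) \<and> sum t A = 1 \<and>
     \<mu> = (\<lambda>\<phi>. \<Sum>x\<in>A. t x * \<phi> x))"

section \<open>Operations on atomic measures\<close>

lemma atomic_mono: "atomic r D \<mu> \<Longrightarrow> D \<subseteq> D' \<Longrightarrow> atomic r D' \<mu>"
  unfolding atomic_def by blast

lemma atomic_cong:
  assumes "atomic r D \<mu>" "\<And>x. x \<in> D \<Longrightarrow> \<phi> x = \<psi> x"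
  shows "\<mu> \<phi> = \<mu> \<psi>"
proof -
  obtain A t where A: "A \<subseteq> D" "\<mu> = (\<lambda>\<phi>. \<Sum>x\<in>A. t x * \<phi> x)"
    using assms(1) unfolding atomic_def by blast
  show ?thesis unfolding A(2) by (intro sum.cong refl) (use A(1) assms(2) in auto)
qed

lemma atomic_diff_le:
  assumes "atomic r D \<mu>" "\<And>x. x \<in> D \<Longrightarrow> \<bar>\<phi> x - \<psi> x\<bar> \<le> e"
  shows "\<bar>\<mu> \<phi> - \<mu> \<psi>\<bar> \<le> e"
proof -
  obtain A t where A: "A \<subseteq> D" "\<forall>x\<in>A. 0 \<le> t x" "sum t A = 1" "\<mu> = (\<lambda>\<phi>. \<Sum>x\<in>A. t x * \<phi> x)"
    using assms(1) unfolding atomic_def by blast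
  have "\<bar>\<mu> \<phi> - \<mu> \<psi>\<bar> = \<bar>\<Sum>x\<in>A. t x * (\<phi> x - \<psi> x)\<bar>"
    by (simp add: A(4) right_diff_distrib sum_subtractf)
  also have "\<dots> \<le> (\<Sum>x\<in>A. \<bar>t x * (\<phi> x - \<psi> x)\<bar>)" by (rule sum_abs)
  also have "\<dots> \<le> (\<Sum>x\<in>A. t x * e)"
    using A assms(2) by (intro sum_mono) (auto simp: abs_mult intro!: mult_left_mono)
  also have "\<dots> = e" using A(3) by (simp flip: sum_distrib_right)
  finally show ?thesis .
qed

text \<open>Atoms with the same image add up their masses. Prescribing the finite set
  \<open>B\<close> allows a later mixture with a point mass inside \<open>B\<close>.\<close>

lemma atomic_pushforward_into:
  assumes "atomic r D \<mu>" and B: "finite B" and h: "\<And>x. x \<in> D \<Longrightarrow> h x \<in> B"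
  shows "\<exists>t. (\<forall>y\<in>B. 0 \<le> t y) \<and> sum t B = 1 \<and> (\<forall>\<phi>. \<mu> (\<lambda>x. \<phi> (h x)) = (\<Sum>y\<in>B. t y * \<phi> y))"
proof -
  obtain A t where A: "finite A" "A \<subseteq> D" "\<forall>x\<in>A. 0 \<le> t x" "sum t A = 1" "\<mu> = (\<lambda>\<phi>. \<Sum>x\<in>A. t x * \<phi> x)"
    using assms(1) unfolding atomic_def by blast
  define t' where "t' = (\<lambda>y. \<Sum>x\<in>{x\<in>A. h x = y}. t x)"
  have hA: "h ` A \<subseteq> B" using A(2) h by blast
  have "\<mu> (\<lambda>x. \<phi> (h x)) = (\<Sum>y\<in>B. t' y * \<phi> y)" for \<phi>
  proof -
    have "\<mu> (\<lambda>x. \<phi> (h x)) = (\<Sum>y\<in>B. \<Sum>x\<in>{x\<in>A. h x = y}. t x * \<phi> (h x))"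
      using sum.group[OF A(1) B hA, of "\<lambda>x. t x * \<phi> (h x)"] by (simp add: A(5))
    then show ?thesis by (simp add: t'_def sum_distrib_right)
  qed
  moreover have "sum t' B = 1"
    using sum.group[OF A(1) B hA, of t] A(4) by (simp add: t'_def)
  moreover have "\<forall>y\<in>B. 0 \<le> t' y" using A(3) by (auto simp: t'_def intro!: sum_nonneg)
  ultimately show ?thesis by blast
qed

text \<open>Under a map atoms can merge but not split, so their number does not grow.\<close>

lemma atomic_pushforward:
  assumes \<mu>: "atomic r D \<mu>" and h: "\<And>x. x \<in> D \<Longrightarrow> h x \<in> E"
  shows "atomic r E (\<lambda>\<phi>. \<mu> (\<lambda>x. \<phi> (h x)))"
proof -
  obtain A t where A: "finite A" "card A \<le> r" "A \<subseteq> D" "\<forall>x\<in>A. 0 \<le> t x" "sum t A = 1"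
      "\<mu> = (\<lambda>\<phi>. \<Sum>x\<in>A. t x * \<phi> x)"
    using assms(1) unfolding atomic_def by blast
  then have "atomic r A \<mu>" unfolding atomic_def by blast
  then have "\<exists>t. (\<forall>y\<in>h ` A. 0 \<le> t y) \<and> sum t (h ` A) = 1 \<and>
      (\<forall>\<phi>. \<mu> (\<lambda>x. \<phi> (h x)) = (\<Sum>y\<in>h ` A. t y * \<phi> y))"
    by (rule atomic_pushforward_into) (use A(1) in auto)
  moreover have "card (h ` A) \<le> r" using A card_image_le order_trans by blast
  moreover have "h ` A \<subseteq> E" using A(3) h by blast
  ultimately show ?thesis unfolding atomic_def using finite_imageI[OF A(1), of h] by (metis (no_types, lifting) ext)
qed

text \<open>Both the image measure and the point mass at \<open>a\<close> live on \<open>X\<close>,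
  so \<open>card X\<close> bounds the number of atoms of any mixture.\<close>

lemma atomic_mix:
  assumes \<mu>: "atomic r D \<mu>" and X: "finite X" "card X \<le> s" "X \<subseteq> E" "a \<in> X"
    and h: "\<And>x. x \<in> D \<Longrightarrow> h x \<in> X" and c: "0 \<le> c" "c \<le> 1"
  shows "atomic s E (\<lambda>\<phi>. (1 - c) * \<mu> (\<lambda>x. \<phi> (h x)) + c * \<phi> a)"
proof -
  obtain t where t: "\<forall>y\<in>X. 0 \<le> t y" "sum t X = 1" "\<And>\<phi>. \<mu> (\<lambda>x. \<phi> (h x)) = (\<Sum>y\<in>X. t y * \<phi> y)"
    using atomic_pushforward_into[of r D \<mu> X h, OF \<mu> X(1) h] by auto
  define t' where "t' = (\<lambda>y. (1 - c) * t y + (if y = a then c else 0))"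
  have "(1 - c) * \<mu> (\<lambda>x. \<phi> (h x)) + c * \<phi> a = (\<Sum>y\<in>X. t' y * \<phi> y)" for \<phi>
  proof -
    have "(\<Sum>y\<in>X. t' y * \<phi> y) = (\<Sum>y\<in>X. (1 - c) * (t y * \<phi> y) + (if y = a then c * \<phi> y else 0))"
      by (intro sum.cong) (auto simp: t'_def algebra_simps)
    then show ?thesis using X by (simp add: t(3) sum.distrib sum.delta sum_distrib_left)
  qed
  moreover have "sum t' X = 1"
    using X t(2) by (simp add: t'_def sum.distrib sum.delta flip: sum_distrib_left)
  moreover have "\<forall>y\<in>X. 0 \<le> t' y" using t(1) c by (auto simp: t'_def)
  ultimately show ?thesis unfolding atomic_def using X by blast
qed

text \<open>Padding with weight 0 at an existing atom gives exactly \<open>r\<close> weights and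
  points, the form needed for counting parameters.\<close>

lemma atomic_indexed:
  assumes "atomic r D \<mu>"
  shows "\<exists>t x. (\<forall>k<r. 0 \<le> t k \<and> x k \<in> D) \<and> (\<Sum>k<r. t k) = 1 \<and>
    (\<forall>\<phi>. \<mu> \<phi> = (\<Sum>k<r. t k * \<phi> (x k)))"
proof -
  obtain A t where A: "finite A" "card A \<le> r" "A \<subseteq> D" "\<forall>x\<in>A. 0 \<le> t x" "sum t A = 1"
      "\<mu> = (\<lambda>\<phi>. \<Sum>x\<in>A. t x * \<phi> x)"
    using assms(1) unfolding atomic_def by blast
  obtain f where f: "bij_betw f {0..<card A} A" using ex_bij_betw_nat_finite[OF A(1)] by blast
  have "A \<noteq> {}" using A(5) by auto
  then obtain a where a: "a \<in> A" by blast
  define t' where "t' = (\<lambda>k. if k < card A then t (f k) else 0)"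
  define x where "x = (\<lambda>k. if k < card A then f k else a)"
  have sub: "(\<Sum>k<r. t' k * \<phi> (x k)) = (\<Sum>y\<in>A. t y * \<phi> y)" for \<phi>
  proof -
    have "(\<Sum>k<r. t' k * \<phi> (x k)) = (\<Sum>k\<in>{0..<card A}. t' k * \<phi> (x k))"
      using A(2) by (intro sum.mono_neutral_right) (auto simp: t'_def)
    also have "\<dots> = (\<Sum>k\<in>{0..<card A}. t (f k) * \<phi> (f k))"
      by (intro sum.cong) (auto simp: t'_def x_def)
    also have "\<dots> = (\<Sum>y\<in>A. t y * \<phi> y)"
      by (rule sum.reindex_bij_betw[OF f])
    finally show ?thesis .
  qed
  have fA: "f k \<in> A" if "k < card A" for k
    using f that by (auto dest: bij_betwE)
  show ?thesis
  proof (intro exI conjI allI impI)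
    show "0 \<le> t' k" "x k \<in> D" for k
      using fA[of k] A(3,4) a by (auto simp: t'_def x_def)
    show "(\<Sum>k<r. t' k) = 1" using sub[of "\<lambda>_. 1"] A(5) by simp
    show "\<mu> \<phi> = (\<Sum>k<r. t' k * \<phi> (x k))" for \<phi> by (simp add: sub A(6))
  qed
qed

text \<open>Here measure and integrand vary together. Uniform continuity of \<open>F\<close> on the
  compact product lets the integrand be frozen at \<open>s z\<close> with a small uniform error,
  which total mass 1 carries over to the integrals.\<close>

lemma continuous_on_atomic_joint:
  fixes P :: "'c::topological_space \<Rightarrow> ('a::metric_space \<Rightarrow> real) \<Rightarrow> real"
  assumes P: "\<And>z. z \<in> S \<Longrightarrow> atomic r D (P z)"
    and cont: "\<And>\<psi>. continuous_on D \<psi> \<Longrightarrow> continuous_on S (\<lambda>z. P z \<psi>)"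
    and D: "compact D" and F: "continuous_on ({0..1::real} \<times> D) F"
    and s: "continuous_on S s" "s ` S \<subseteq> {0..1}"
  shows "continuous_on S (\<lambda>z. P z (\<lambda>x. F (s z, x)))"
  unfolding continuous_on_def
proof (intro ballI tendstoI)
  fix z and e :: real assume z: "z \<in> S" and e: "0 < e"
  have "uniformly_continuous_on ({0..1} \<times> D) F"
    by (intro compact_uniformly_continuous F compact_Times D) simp
  then obtain d where d: "0 < d" and unif: "\<And>p q. \<lbrakk>p \<in> {0..1} \<times> D; q \<in> {0..1} \<times> D; dist p q < d\<rbrakk>
      \<Longrightarrow> dist (F p) (F q) < e / 2"
    unfolding uniformly_continuous_on_def using e by (meson half_gt_zero)
  have sz: "s w \<in> {0..1}" if "w \<in> S" for w using s(2) that by blast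
  define \<psi> where "\<psi> = (\<lambda>x. F (s z, x))"
  have "continuous_on D \<psi>"
    unfolding \<psi>_def using sz[OF z]
    by (intro continuous_on_compose2[OF F] continuous_intros) auto
  then have "((\<lambda>w. P w \<psi>) \<longlongrightarrow> P z \<psi>) (at z within S)"
    using cont z unfolding continuous_on_def by blast
  then have "\<forall>\<^sub>F w in at z within S. dist (P w \<psi>) (P z \<psi>) < e / 2"
    using e by (intro tendstoD) auto
  moreover have "\<forall>\<^sub>F w in at z within S. dist (s w) (s z) < d"
    using s(1) z d unfolding continuous_on_def by (intro tendstoD) auto
  moreover have "\<forall>\<^sub>F w in at z within S. w \<in> S"
    by (simp add: eventually_at_filter)
  ultimately show "\<forall>\<^sub>F w in at z within S. dist (P w (\<lambda>x. F (s w, x))) (P z (\<lambda>x. F (s z, x))) < e"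
  proof eventually_elim
    case (elim w)
    have "\<bar>P w (\<lambda>x. F (s w, x)) - P w \<psi>\<bar> \<le> e / 2"
    proof (rule atomic_diff_le[OF P[OF elim(3)]])
      fix x assume "x \<in> D"
      then show "\<bar>F (s w, x) - \<psi> x\<bar> \<le> e / 2"
        using unif[of "(s w, x)" "(s z, x)"] sz[OF elim(3)] sz[OF z] elim(2)
        by (simp add: \<psi>_def dist_Pair_Pair dist_real_def)
    qed
    then show ?case using elim(1) unfolding \<psi>_def dist_real_def by linarith
  qed
qed

section \<open>Filling the simplex with atomic measures\<close>

text \<open>
The point \<open>z\<close> of the face \<open>\<sigma>\<close> divides the segment from \<open>face_proj \<sigma> z\<close>, on the relative boundary,
to the barycentre of \<open>\<sigma>\<close> in the ratio given by \<open>face_depth \<sigma> z\<close>. At the barycentre itself the depth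
is 1 and division by 0 makes the projection a junk value.
\<close>

definition face_depth :: "nat set \<Rightarrow> (nat \<Rightarrow> real) \<Rightarrow> real" where
  "face_depth \<sigma> z = real (card \<sigma>) * Min (z ` \<sigma>)"

definition face_proj :: "nat set \<Rightarrow> (nat \<Rightarrow> real) \<Rightarrow> nat \<Rightarrow> real" where
  "face_proj \<sigma> z i = (if i \<in> \<sigma> then (z i - Min (z ` \<sigma>)) / (1 - face_depth \<sigma> z) else 0)"

section \<open>Geometry of the faces of the simplex\<close>

lemma std_face_nonempty_finite: "z \<in> std_face \<sigma> \<Longrightarrow> finite \<sigma> \<and> \<sigma> \<noteq> {}"
  by (cases "finite \<sigma>") (auto simp: std_face_def)

lemma std_face_remove:
  assumes "z \<in> std_face \<sigma>" "z i = 0"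
  shows "z \<in> std_face (\<sigma> - {i})"
proof -
  have "finite \<sigma>" using std_face_nonempty_finite[OF assms(1)] by simp
  then have "sum z \<sigma> = sum z (\<sigma> - {i})"
    using assms by (intro sum.mono_neutral_right) auto
  then show ?thesis using assms by (auto simp: std_face_def)
qed

lemma closed_std_face: "closed (std_face \<sigma>)"
proof -
  have "std_face \<sigma> = (\<Inter>i. {z. 0 \<le> z i}) \<inter> (\<Inter>i\<in>- \<sigma>. {z. z i = 0}) \<inter> {z. sum z \<sigma> = 1}"
    by (auto simp: std_face_def)
  then show ?thesis
    by (auto intro!: closed_Int closed_INT closed_Collect_le closed_Collect_eq continuous_on_sum)
qed

lemma continuous_on_Min_coords:
  fixes \<sigma> :: "nat set"
  assumes "finite \<sigma>" "\<sigma> \<noteq> {}"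
  shows "continuous_on S (\<lambda>z::nat \<Rightarrow> real. Min (z ` \<sigma>))"
proof -
  have coord: "continuous_on S (\<lambda>z::nat \<Rightarrow> real. z j)" for j
    by (rule continuous_on_subset[OF continuous_on_product_coordinates]) simp
  show ?thesis
    using assms
  proof (induction rule: finite_ne_induct)
    case (insert x F)
    then have "Min (z ` insert x F) = min (z x) (Min (z ` F))" for z :: "nat \<Rightarrow> real" by simp
    then show ?case using insert.IH by (simp add: continuous_on_min coord)
  qed (simp add: coord)
qed

lemma continuous_on_face_depth:
  assumes "finite \<sigma>" "\<sigma> \<noteq> {}"
  shows "continuous_on S (face_depth \<sigma>)"
  unfolding face_depth_def[abs_def] using assms by (intro continuous_intros continuous_on_Min_coords)

lemma continuous_on_face_proj:
  assumes "finite \<sigma>" "\<sigma> \<noteq> {}"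
  shows "continuous_on {z \<in> S. face_depth \<sigma> z < 1} (face_proj \<sigma>)"
proof (rule continuous_on_coordinatewise_then_product)
  fix i
  have coord: "continuous_on T (\<lambda>z::nat \<Rightarrow> real. z j)" for T j
    by (rule continuous_on_subset[OF continuous_on_product_coordinates]) simp
  show "continuous_on {z \<in> S. face_depth \<sigma> z < 1} (\<lambda>z. face_proj \<sigma> z i)"
    unfolding face_proj_def[abs_def] using assms
    by (cases "i \<in> \<sigma>")
      (auto intro!: continuous_intros coord continuous_on_Min_coords continuous_on_face_depth)
qed

lemma face_depth_bounds:
  assumes z: "z \<in> std_face \<sigma>"
  shows "0 \<le> face_depth \<sigma> z" "face_depth \<sigma> z \<le> 1"
proof -
  have fin: "finite \<sigma>" "\<sigma> \<noteq> {}" using std_face_nonempty_finite[OF z] by auto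
  show "0 \<le> face_depth \<sigma> z"
    using fin z by (auto simp: face_depth_def std_face_def)
  have "(\<Sum>i\<in>\<sigma>. Min (z ` \<sigma>)) \<le> sum z \<sigma>" using fin by (intro sum_mono) auto
  then show "face_depth \<sigma> z \<le> 1" using z by (simp add: face_depth_def std_face_def)
qed

text \<open>These equations make a cone over boundary data agree with those data on the
  boundary.\<close>

lemma face_proj_on_boundary:
  assumes z: "z \<in> std_face \<sigma>" and i: "i \<in> \<sigma>" "z i = 0"
  shows "face_depth \<sigma> z = 0" "face_proj \<sigma> z = z"
proof -
  have fin: "finite \<sigma>" using std_face_nonempty_finite[OF z] by auto
  have M: "Min (z ` \<sigma>) = 0"
    using fin i z by (intro Min_eqI) (auto simp: std_face_def image_iff intro: bexI[of _ i])
  then show d: "face_depth \<sigma> z = 0" by (simp add: face_depth_def)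
  show "face_proj \<sigma> z = z" using z by (auto simp: face_proj_def M d std_face_def)
qed

text \<open>Subtracting the minimum kills a coordinate attaining it, and dividing by
  \<open>1 - face_depth \<sigma> z\<close> restores coordinate sum 1.\<close>

lemma face_proj_in_boundary:
  assumes z: "z \<in> std_face \<sigma>" and c: "face_depth \<sigma> z < 1"
  shows "\<exists>i\<in>\<sigma>. face_proj \<sigma> z \<in> std_face (\<sigma> - {i})"
proof -
  have fin: "finite \<sigma>" "\<sigma> \<noteq> {}" using std_face_nonempty_finite[OF z] by auto
  have "Min (z ` \<sigma>) \<in> z ` \<sigma>" using fin by (intro Min_in) auto
  then obtain i where i: "i \<in> \<sigma>" "z i = Min (z ` \<sigma>)" by auto
  have "(\<Sum>j\<in>\<sigma>. face_proj \<sigma> z j) = (\<Sum>j\<in>\<sigma>. (z j - Min (z ` \<sigma>))) / (1 - face_depth \<sigma> z)"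
    by (simp add: face_proj_def sum_divide_distrib)
  also have "\<dots> = 1" using c z by (simp add: sum_subtractf face_depth_def std_face_def)
  finally have "face_proj \<sigma> z \<in> std_face \<sigma>"
    using fin c by (auto simp: std_face_def face_proj_def)
  moreover have "face_proj \<sigma> z i = 0" using i by (simp add: face_proj_def)
  ultimately show ?thesis using std_face_remove i by blast
qed

text \<open>Abstracts a union of at most \<open>r\<close> contractible components: \<open>X\<close>
  collects their centres. The chosen centre \<open>a\<close> serves as apex of cones of measures and
  forces \<open>D\<close> to be nonempty.\<close>

definition contracts_to_few :: "nat \<Rightarrow> 'a::topological_space set \<Rightarrow> bool" where
  "contracts_to_few r D \<longleftrightarrow> (\<exists>H a X. finite X \<and> card X \<le> r \<and> X \<subseteq> D \<and> a \<in> X \<and>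
     continuous_on ({0..1::real} \<times> D) H \<and> H ` ({0..1} \<times> D) \<subseteq> D \<and>
     (\<forall>x\<in>D. H (0, x) = x) \<and> (\<forall>x\<in>D. H (1, x) \<in> X))"

text \<open>
For \<open>c \<le> 1/2\<close> the measure is pushed along the homotopy \<open>H\<close>; for \<open>c \<ge> 1/2\<close> it lives on the
finite set reached by \<open>H\<close> and is mixed with the point mass at \<open>a\<close>. At \<open>c = 1\<close> the factor 0 removes
any dependence on \<open>\<mu>\<close>, so \<open>\<mu>\<close> may be junk there.
\<close>

definition cone_to :: "(real \<times> 'a \<Rightarrow> 'a) \<Rightarrow> 'a \<Rightarrow> real \<Rightarrow> (('a \<Rightarrow> real) \<Rightarrow> real) \<Rightarrow> ('a \<Rightarrow> real) \<Rightarrow> real" where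
  "cone_to H a c \<mu> \<phi> = (1 - max 0 (2 * c - 1)) * \<mu> (\<lambda>x. \<phi> (H (min 1 (2 * c), x))) + max 0 (2 * c - 1) * \<phi> a"

lemma atomic_cone:
  assumes \<mu>: "c < 1 \<Longrightarrow> atomic r D \<mu>" and c: "0 \<le> c" "c \<le> 1"
    and X: "finite X" "card X \<le> r" "X \<subseteq> D" "a \<in> X"
    and H: "H ` ({0..1} \<times> D) \<subseteq> D" "\<And>x. x \<in> D \<Longrightarrow> H (1, x) \<in> X"
  shows "atomic r D (cone_to H a c \<mu>)"
proof -
  consider "c \<le> 1 / 2" | "1 / 2 < c" "c < 1" | "c = 1" using c by linarith
  then show ?thesis
  proof cases
    case 1
    then have "max 0 (2 * c - 1) = 0" "min 1 (2 * c) = 2 * c" by auto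
    then have "cone_to H a c \<mu> = (\<lambda>\<phi>. \<mu> (\<lambda>x. \<phi> (H (2 * c, x))))"
      by (simp add: fun_eq_iff cone_to_def)
    moreover have "atomic r D (\<lambda>\<phi>. \<mu> (\<lambda>x. \<phi> (H (2 * c, x))))"
      by (rule atomic_pushforward[OF \<mu>]) (use 1 c H(1) in auto)
    ultimately show ?thesis by simp
  next
    case 2
    then have "max 0 (2 * c - 1) = 2 * c - 1" "min 1 (2 * c) = 1" by auto
    then have "cone_to H a c \<mu> = (\<lambda>\<phi>. (1 - (2 * c - 1)) * \<mu> (\<lambda>x. \<phi> (H (1, x))) + (2 * c - 1) * \<phi> a)"
      by (simp add: fun_eq_iff cone_to_def)
    moreover have "atomic r D (\<lambda>\<phi>. (1 - (2 * c - 1)) * \<mu> (\<lambda>x. \<phi> (H (1, x))) + (2 * c - 1) * \<phi> a)"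
      by (rule atomic_mix[OF \<mu> X(1-4) H(2)]) (use 2 in auto)
    ultimately show ?thesis by simp
  next
    case 3
    then have "cone_to H a c \<mu> = (\<lambda>\<phi>. \<Sum>x\<in>{a}. 1 * \<phi> x)" by (auto simp: fun_eq_iff cone_to_def)
    moreover have "card {a} \<le> r" using X card_mono[of X "{a}"] by auto
    ultimately show ?thesis
      unfolding atomic_def using X by (intro exI[of _ "{a}"] exI[of _ "\<lambda>_. 1"]) auto
  qed
qed

text \<open>Away from the barycentre this is a composition of continuous maps. At the barycentre the
  projection breaks down, but the weight of the projected measure tends to 0 there.\<close>

lemma continuous_on_cone:
  fixes D :: "'a::metric_space set" and P :: "(nat \<Rightarrow> real) \<Rightarrow> ('a \<Rightarrow> real) \<Rightarrow> real"
  assumes P: "\<And>i z. \<lbrakk>i \<in> \<sigma>; z \<in> std_face (\<sigma> - {i})\<rbrakk> \<Longrightarrow> atomic r D (P z)"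
    and contP: "\<And>i \<psi>. \<lbrakk>i \<in> \<sigma>; continuous_on D \<psi>\<rbrakk> \<Longrightarrow> continuous_on (std_face (\<sigma> - {i})) (\<lambda>z. P z \<psi>)"
    and D: "compact D" and H: "continuous_on ({0..1} \<times> D) H" "H ` ({0..1} \<times> D) \<subseteq> D"
    and a: "a \<in> D" and \<phi>: "continuous_on D \<phi>"
  shows "continuous_on (std_face \<sigma>) (\<lambda>z. cone_to H a (face_depth \<sigma> z) (P (face_proj \<sigma> z)) \<phi>)"
    (is "continuous_on ?T ?N")
proof (cases "?T = {}")
  case False
  then have fin: "finite \<sigma>" "\<sigma> \<noteq> {}" using std_face_nonempty_finite by auto
  let ?c = "face_depth \<sigma>"
  define U where "U = {z \<in> ?T. ?c z < 1}"
  have bd: "face_proj \<sigma> ` U \<subseteq> (\<Union>i\<in>\<sigma>. std_face (\<sigma> - {i}))"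
    using face_proj_in_boundary by (auto simp: U_def)
  \<comment> \<open>The facets are finitely many closed sets, so continuity on each of them gives
    continuity on the whole relative boundary.\<close>
  have cont_PU: "continuous_on U (\<lambda>z. P (face_proj \<sigma> z) \<psi>)" if "continuous_on D \<psi>" for \<psi>
  proof (rule continuous_on_compose2[OF _ _ bd])
    show "continuous_on (\<Union>i\<in>\<sigma>. std_face (\<sigma> - {i})) (\<lambda>z. P z \<psi>)"
      using fin that by (intro continuous_on_closed_Union closed_std_face contP)
    show "continuous_on U (face_proj \<sigma>)"
      unfolding U_def by (rule continuous_on_face_proj[OF fin])
  qed
  have c_cont: "continuous_on S ?c" for S by (rule continuous_on_face_depth[OF fin])
  have at_PU: "atomic r D (P (face_proj \<sigma> z))" if "z \<in> U" for z
    using bd that P by blast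
  have "continuous_on U (\<lambda>z. P (face_proj \<sigma> z) (\<lambda>x. (\<phi> \<circ> H) (min 1 (2 * ?c z), x)))"
  proof (rule continuous_on_atomic_joint[OF at_PU cont_PU D])
    show "continuous_on ({0..1} \<times> D) (\<phi> \<circ> H)"
      by (intro continuous_on_compose H continuous_on_subset[OF \<phi>])
    show "continuous_on U (\<lambda>z. min 1 (2 * ?c z))"
      by (intro continuous_intros c_cont)
    show "(\<lambda>z. min 1 (2 * ?c z)) ` U \<subseteq> {0..1}"
      using face_depth_bounds by (auto simp: U_def)
  qed auto
  then have NU: "continuous_on U ?N"
    unfolding cone_to_def by (auto simp: o_def intro!: continuous_intros c_cont)
  \<comment> \<open>\<open>U\<close> is relatively open, so at its points limits within
    \<open>U\<close> are limits within the face.\<close>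
  have "openin (top_of_set ?T) (?T \<inter> ?c -` {..<1})"
    by (rule continuous_openin_preimage_gen[OF c_cont]) simp
  then obtain V where V: "open V" "U = ?T \<inter> V"
    by (auto simp: U_def openin_open vimage_def Int_def)
  obtain B where B: "\<And>x. x \<in> D \<Longrightarrow> \<bar>\<phi> x\<bar> \<le> B"
    using compact_imp_bounded[OF compact_continuous_image[OF \<phi> D]] by (auto simp: bounded_real)
  show ?thesis
    unfolding continuous_on_def
  proof
    fix z assume z: "z \<in> ?T"
    show "(?N \<longlongrightarrow> ?N z) (at z within ?T)"
    proof (cases "?c z < 1")
      case True
      then have zU: "z \<in> U" using z by (simp add: U_def)
      then have "(?N \<longlongrightarrow> ?N z) (at z within U)" using NU unfolding continuous_on_def by blast
      moreover have "at z within U = at z within ?T"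
        unfolding V(2) using V zU by (intro at_within_nhd[of _ V]) auto
      ultimately show ?thesis by simp
    next
      case False
      then have cz: "?c z = 1" using face_depth_bounds(2)[OF z] by linarith
      then have Nz: "?N z = \<phi> a" by (simp add: cone_to_def)
      \<comment> \<open>The remaining weight times the largest possible change \<open>2 * B\<close>
        of \<open>\<phi>\<close> on \<open>D\<close>; it vanishes as the depth tends to 1.\<close>
      have bound: "\<bar>?N w - \<phi> a\<bar> \<le> (1 - max 0 (2 * ?c w - 1)) * (2 * B)" if w: "w \<in> ?T" for w
      proof (cases "?c w < 1")
        case True
        then have wU: "w \<in> U" using w by (simp add: U_def)
        have cw: "0 \<le> ?c w" using face_depth_bounds(1)[OF w] .
        let ?m = "max 0 (2 * ?c w - 1)" and ?\<mu> = "P (face_proj \<sigma> w)"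
        have HD: "H (min 1 (2 * ?c w), x) \<in> D" if "x \<in> D" for x
          using H(2) that cw by auto
        have "\<bar>?\<mu> (\<lambda>x. \<phi> (H (min 1 (2 * ?c w), x))) - ?\<mu> (\<lambda>x. \<phi> a)\<bar> \<le> 2 * B"
          by (rule atomic_diff_le[OF at_PU[OF wU]]) (use B[OF HD] B[OF a] in fastforce)
        moreover have "?\<mu> (\<lambda>x. \<phi> a) = \<phi> a"
          using at_PU[OF wU] unfolding atomic_def by (auto simp flip: sum_distrib_right)
        ultimately have "(1 - ?m) * \<bar>?\<mu> (\<lambda>x. \<phi> (H (min 1 (2 * ?c w), x))) - \<phi> a\<bar> \<le> (1 - ?m) * (2 * B)"
          using True by (intro mult_left_mono) auto
        moreover have "?N w - \<phi> a = (1 - ?m) * (?\<mu> (\<lambda>x. \<phi> (H (min 1 (2 * ?c w), x))) - \<phi> a)"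
          by (simp add: cone_to_def algebra_simps)
        moreover have "\<bar>1 - ?m\<bar> = 1 - ?m" using True by simp
        ultimately show ?thesis by (simp add: abs_mult)
      next
        case False
        then have "?c w = 1" using face_depth_bounds(2)[OF w] by linarith
        then show ?thesis by (simp add: cone_to_def)
      qed
      have "((\<lambda>w. (1 - max 0 (2 * ?c w - 1)) * (2 * B)) \<longlongrightarrow> (1 - max 0 (2 * ?c z - 1)) * (2 * B)) (at z within ?T)"
        using c_cont[of ?T] z unfolding continuous_on_def by (intro tendsto_intros) auto
      then have lim0: "((\<lambda>w. (1 - max 0 (2 * ?c w - 1)) * (2 * B)) \<longlongrightarrow> 0) (at z within ?T)"
        by (simp add: cz)
      have "((\<lambda>w. ?N w - \<phi> a) \<longlongrightarrow> 0) (at z within ?T)"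
        by (rule Lim_null_comparison[OF _ lim0]) (use bound in \<open>auto simp: eventually_at_filter\<close>)
      then show ?thesis unfolding Nz by (rule LIM_zero_cancel)
    qed
  qed
qed simp

text \<open>Induction over skeleta: the family on the boundary of a face \<open>\<sigma>\<close>
  takes values in measures on \<open>D \<sigma>\<close> by \<open>mono\<close>, and coning to
  \<open>a \<sigma>\<close> extends it over the interior.\<close>

theorem atomic_family_on_simplex:
  fixes D :: "nat set \<Rightarrow> 'a::metric_space set"
  assumes V: "finite V"
    and contr: "\<And>\<sigma>. \<lbrakk>\<sigma> \<subseteq> V; \<sigma> \<noteq> {}\<rbrakk> \<Longrightarrow> compact (D \<sigma>) \<and> contracts_to_few r (D \<sigma>)"
    and mono: "\<And>\<sigma> \<tau>. \<lbrakk>\<tau> \<subseteq> \<sigma>; \<sigma> \<subseteq> V\<rbrakk> \<Longrightarrow> D \<tau> \<subseteq> D \<sigma>"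
  shows "\<exists>M. \<forall>\<sigma>\<subseteq>V. (\<forall>z\<in>std_face \<sigma>. atomic r (D \<sigma>) (M z)) \<and>
    (\<forall>\<phi>. continuous_on (D \<sigma>) \<phi> \<longrightarrow> continuous_on (std_face \<sigma>) (\<lambda>z. M z \<phi>))"
proof -
  have "\<forall>\<sigma>\<in>{\<sigma>. \<sigma> \<subseteq> V \<and> \<sigma> \<noteq> {}}. \<exists>H a X. finite X \<and> card X \<le> r \<and> X \<subseteq> D \<sigma> \<and> a \<in> X \<and>
     continuous_on ({0..1::real} \<times> D \<sigma>) H \<and> H ` ({0..1} \<times> D \<sigma>) \<subseteq> D \<sigma> \<and>
     (\<forall>x\<in>D \<sigma>. H (0, x) = x) \<and> (\<forall>x\<in>D \<sigma>. H (1, x) \<in> X)"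
    using contr unfolding contracts_to_few_def by blast
  then obtain H where "\<forall>\<sigma>\<in>{\<sigma>. \<sigma> \<subseteq> V \<and> \<sigma> \<noteq> {}}. \<exists>a X. finite X \<and> card X \<le> r \<and> X \<subseteq> D \<sigma> \<and> a \<in> X \<and>
     continuous_on ({0..1::real} \<times> D \<sigma>) (H \<sigma>) \<and> H \<sigma> ` ({0..1} \<times> D \<sigma>) \<subseteq> D \<sigma> \<and>
     (\<forall>x\<in>D \<sigma>. H \<sigma> (0, x) = x) \<and> (\<forall>x\<in>D \<sigma>. H \<sigma> (1, x) \<in> X)"
    by (rule bchoice[THEN exE])
  then obtain a where Ha: "\<forall>\<sigma>\<in>{\<sigma>. \<sigma> \<subseteq> V \<and> \<sigma> \<noteq> {}}. \<exists>X. finite X \<and> card X \<le> r \<and> X \<subseteq> D \<sigma> \<and> a \<sigma> \<in> X \<and>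
     continuous_on ({0..1::real} \<times> D \<sigma>) (H \<sigma>) \<and> H \<sigma> ` ({0..1} \<times> D \<sigma>) \<subseteq> D \<sigma> \<and>
     (\<forall>x\<in>D \<sigma>. H \<sigma> (0, x) = x) \<and> (\<forall>x\<in>D \<sigma>. H \<sigma> (1, x) \<in> X)"
    by (rule bchoice[THEN exE])
  have "\<exists>M. \<forall>\<sigma>. \<sigma> \<subseteq> V \<and> card \<sigma> \<le> k \<longrightarrow> (\<forall>z\<in>std_face \<sigma>. atomic r (D \<sigma>) (M z)) \<and>
    (\<forall>\<phi>. continuous_on (D \<sigma>) \<phi> \<longrightarrow> continuous_on (std_face \<sigma>) (\<lambda>z. M z \<phi>))" for k
  proof (induction k)
    case 0
    have "std_face \<sigma> = {}" if "\<sigma> \<subseteq> V" "card \<sigma> \<le> 0" for \<sigma>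
      using that V finite_subset std_face_nonempty_finite by (metis card_0_eq equals0I le_zero_eq)
    then show ?case by auto
  next
    case (Suc k)
    then obtain M where M0: "\<forall>\<sigma>. \<sigma> \<subseteq> V \<and> card \<sigma> \<le> k \<longrightarrow> (\<forall>z\<in>std_face \<sigma>. atomic r (D \<sigma>) (M z)) \<and>
        (\<forall>\<phi>. continuous_on (D \<sigma>) \<phi> \<longrightarrow> continuous_on (std_face \<sigma>) (\<lambda>z. M z \<phi>))"
      by (rule exE)
    have M: "atomic r (D \<sigma>) (M z)" if "\<sigma> \<subseteq> V" "card \<sigma> \<le> k" "z \<in> std_face \<sigma>" for \<sigma> z
      using M0[rule_format, of \<sigma>] that by simp
    have contM: "continuous_on (std_face \<sigma>) (\<lambda>z. M z \<phi>)"
      if "\<sigma> \<subseteq> V" "card \<sigma> \<le> k" "continuous_on (D \<sigma>) \<phi>" for \<sigma> \<phi>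
      using M0[rule_format, of \<sigma>] that by simp
    \<comment> \<open>The support is the smallest face containing \<open>z\<close>. Choosing the
      cone by it gives a single definition valid on all faces at once.\<close>
    define supp where "supp = (\<lambda>z::nat \<Rightarrow> real. {i. z i \<noteq> 0})"
    define M' where "M' = (\<lambda>z. if card (supp z) \<le> k then M z else
        cone_to (H (supp z)) (a (supp z)) (face_depth (supp z) z) (M (face_proj (supp z) z)))"
    have supp: "supp z \<subseteq> \<sigma>" if "z \<in> std_face \<sigma>" for z \<sigma>
      using that by (auto simp: std_face_def supp_def)
    have old: "M' z = M z" if "\<sigma> \<subseteq> V" "card \<sigma> \<le> k" "z \<in> std_face \<sigma>" for \<sigma> z
    proof -
      have "card (supp z) \<le> card \<sigma>"
        using that V by (intro card_mono supp) (auto intro: finite_subset)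
      then show ?thesis using that by (simp add: M'_def)
    qed
    show ?case
    proof (intro exI[of _ M'] allI impI)
      fix \<sigma> assume \<sigma>: "\<sigma> \<subseteq> V \<and> card \<sigma> \<le> Suc k"
      then have fin: "finite \<sigma>" using V finite_subset by blast
      show "(\<forall>z\<in>std_face \<sigma>. atomic r (D \<sigma>) (M' z)) \<and>
        (\<forall>\<phi>. continuous_on (D \<sigma>) \<phi> \<longrightarrow> continuous_on (std_face \<sigma>) (\<lambda>z. M' z \<phi>))"
      proof (cases "card \<sigma> \<le> k")
        case True
        have "continuous_on (std_face \<sigma>) (\<lambda>z. M' z \<phi>)" if "continuous_on (D \<sigma>) \<phi>" for \<phi>
          using contM[OF conjunct1[OF \<sigma>] True that] by (rule continuous_on_eq) (use \<sigma> True old in auto)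
        then show ?thesis using \<sigma> True old[of \<sigma>] M[of \<sigma>] by simp
      next
        case False
        then have card: "card \<sigma> = Suc k" using \<sigma> by simp
        then have ne: "\<sigma> \<noteq> {}" by auto
        have "\<sigma> \<in> {\<sigma>. \<sigma> \<subseteq> V \<and> \<sigma> \<noteq> {}}" using \<sigma> ne by simp
        from bspec[OF Ha this] obtain X where X: "finite X" "card X \<le> r" "X \<subseteq> D \<sigma>" "a \<sigma> \<in> X"
          and H: "continuous_on ({0..1::real} \<times> D \<sigma>) (H \<sigma>)" "H \<sigma> ` ({0..1} \<times> D \<sigma>) \<subseteq> D \<sigma>"
            "\<And>x. x \<in> D \<sigma> \<Longrightarrow> H \<sigma> (0, x) = x" "\<And>x. x \<in> D \<sigma> \<Longrightarrow> H \<sigma> (1, x) \<in> X"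
          by (elim exE conjE) blast
        have sub: "\<sigma> - {i} \<subseteq> V" "card (\<sigma> - {i}) \<le> k" "D (\<sigma> - {i}) \<subseteq> D \<sigma>" if "i \<in> \<sigma>" for i
          using \<sigma> card that fin mono[of "\<sigma> - {i}" \<sigma>] by auto
        \<comment> \<open>The cone formula also holds on the boundary of \<open>\<sigma>\<close>:
          there the depth is 0, the projection is the identity and \<open>H \<sigma>\<close> at time
          0 fixes \<open>D \<sigma>\<close>.\<close>
        have new: "M' z = cone_to (H \<sigma>) (a \<sigma>) (face_depth \<sigma> z) (M (face_proj \<sigma> z))"
          if z: "z \<in> std_face \<sigma>" for z
        proof (cases "supp z = \<sigma>")
          case True
          then show ?thesis using card by (simp add: M'_def)
        next
          case False
          then obtain i where i: "i \<in> \<sigma>" "z i = 0" using supp[OF z] by (auto simp: supp_def)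
          have zi: "z \<in> std_face (\<sigma> - {i})" by (rule std_face_remove[OF z i(2)])
          have at: "atomic r (D \<sigma>) (M z)"
            using M[OF sub(1,2)[OF i(1)] zi] sub(3)[OF i(1)] by (rule atomic_mono)
          have "M z (\<lambda>x. \<phi> (H \<sigma> (0, x))) = M z \<phi>" for \<phi>
            by (rule atomic_cong[OF at]) (simp add: H(3))
          then have "cone_to (H \<sigma>) (a \<sigma>) (face_depth \<sigma> z) (M (face_proj \<sigma> z)) = M z"
            unfolding face_proj_on_boundary[OF z i] by (simp add: fun_eq_iff cone_to_def)
          then show ?thesis using old[OF sub(1,2)[OF i(1)] zi] by simp
        qed
        have at_bd: "atomic r (D \<sigma>) (M z)" if "i \<in> \<sigma>" "z \<in> std_face (\<sigma> - {i})" for i z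
          using M[OF sub(1,2)[OF that(1)] that(2)] sub(3)[OF that(1)] by (rule atomic_mono)
        show ?thesis
        proof (intro conjI ballI allI impI)
          fix z assume z: "z \<in> std_face \<sigma>"
          show "atomic r (D \<sigma>) (M' z)"
            unfolding new[OF z]
          proof (rule atomic_cone[OF _ _ _ X H(2,4)])
            assume "face_depth \<sigma> z < 1"
            then show "atomic r (D \<sigma>) (M (face_proj \<sigma> z))"
              using face_proj_in_boundary[OF z] at_bd by blast
          qed (use face_depth_bounds[OF z] in auto)
        next
          fix \<phi> :: "'a \<Rightarrow> real" assume \<phi>: "continuous_on (D \<sigma>) \<phi>"
          have "continuous_on (std_face \<sigma>)
              (\<lambda>z. cone_to (H \<sigma>) (a \<sigma>) (face_depth \<sigma> z) (M (face_proj \<sigma> z)) \<phi>)"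
          proof (rule continuous_on_cone[OF at_bd _ _ H(1,2) _ \<phi>])
            show "compact (D \<sigma>)" using contr \<sigma> ne by blast
            show "a \<sigma> \<in> D \<sigma>" using X by blast
            show "continuous_on (std_face (\<sigma> - {i})) (\<lambda>z. M z \<psi>)"
              if "i \<in> \<sigma>" "continuous_on (D \<sigma>) \<psi>" for i \<psi>
              using sub[OF that(1)] that(2) by (intro contM) (auto intro: continuous_on_subset)
          qed
          then show "continuous_on (std_face \<sigma>) (\<lambda>z. M' z \<phi>)"
            by (rule continuous_on_eq) (simp add: new)
        qed
      qed
    qed
  qed
  from this[of "card V"] obtain M where M: "\<forall>\<sigma>. \<sigma> \<subseteq> V \<and> card \<sigma> \<le> card V \<longrightarrow>
      (\<forall>z\<in>std_face \<sigma>. atomic r (D \<sigma>) (M z)) \<and>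
      (\<forall>\<phi>. continuous_on (D \<sigma>) \<phi> \<longrightarrow> continuous_on (std_face \<sigma>) (\<lambda>z. M z \<phi>))"
    by (rule exE)
  show ?thesis
    by (intro exI[of _ M] allI impI) (use M card_mono[OF V] in simp)
qed

section \<open>The Helly number\<close>

text \<open>The members are closed, disjoint and finitely many, so their contractions paste to one
  homotopy ending in the set of centres.\<close>

lemma contracts_to_few_Union:
  fixes \<S> :: "'a::euclidean_space set set"
  assumes fin: "finite \<S>" and card: "card \<S> \<le> r" and disj: "disjoint \<S>"
    and sets: "\<And>C. C \<in> \<S> \<Longrightarrow> compact C \<and> contractible C" and ne: "\<Union>\<S> \<noteq> {}"
  shows "contracts_to_few r (\<Union>\<S>)"
proof -
  \<comment> \<open>Empty members have no centre to contract to.\<close>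
  define \<T> where "\<T> = \<S> - {{}}"
  have fin': "finite \<T>" and U: "\<Union>\<S> = \<Union>\<T>" using fin by (auto simp: \<T>_def)
  have "\<exists>h a. a \<in> C \<and> continuous_on ({0..1::real} \<times> C) h \<and> h ` ({0..1} \<times> C) \<subseteq> C \<and>
      (\<forall>x\<in>C. h (0, x) = x) \<and> (\<forall>x\<in>C. h (1, x) = a)" if C: "C \<in> \<T>" for C
  proof -
    have "contractible C" using sets C by (auto simp: \<T>_def)
    then obtain a where "homotopic_with_canon (\<lambda>x. True) C C id (\<lambda>x. a)"
      unfolding contractible_def by blast
    then obtain h where h: "continuous_on ({0..1::real} \<times> C) h" "h ` ({0..1} \<times> C) \<subseteq> C"
        "\<forall>x. h (0, x) = x" "\<forall>x. h (1, x) = a"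
      unfolding homotopic_with_def by auto
    \<comment> \<open>That \<open>a\<close> lies in \<open>C\<close> follows by following any point
      of \<open>C\<close> to the end of the homotopy.\<close>
    obtain x where "x \<in> C" using C by (auto simp: \<T>_def)
    then have "h (1, x) \<in> C" using h(2) by auto
    then show ?thesis using h by (intro exI[of _ h] exI[of _ a]) auto
  qed
  then have "\<forall>C\<in>\<T>. \<exists>h a. a \<in> C \<and> continuous_on ({0..1::real} \<times> C) h \<and> h ` ({0..1} \<times> C) \<subseteq> C \<and>
      (\<forall>x\<in>C. h (0, x) = x) \<and> (\<forall>x\<in>C. h (1, x) = a)" by simp
  then obtain h where "\<forall>C\<in>\<T>. \<exists>a. a \<in> C \<and> continuous_on ({0..1::real} \<times> C) (h C) \<and>
      h C ` ({0..1} \<times> C) \<subseteq> C \<and> (\<forall>x\<in>C. h C (0, x) = x) \<and> (\<forall>x\<in>C. h C (1, x) = a)"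
    by (rule bchoice[THEN exE])
  then obtain a where ha: "\<forall>C\<in>\<T>. a C \<in> C \<and> continuous_on ({0..1::real} \<times> C) (h C) \<and>
      h C ` ({0..1} \<times> C) \<subseteq> C \<and> (\<forall>x\<in>C. h C (0, x) = x) \<and> (\<forall>x\<in>C. h C (1, x) = a C)"
    by (rule bchoice[THEN exE])
  define comp where "comp = (\<lambda>x. THE C. C \<in> \<T> \<and> x \<in> C)"
  have comp: "comp x = C" if "C \<in> \<T>" "x \<in> C" for C x
    unfolding comp_def
  proof (rule the_equality)
    show "C' = C" if "C' \<in> \<T> \<and> x \<in> C'" for C'
      using disj that \<open>C \<in> \<T>\<close> \<open>x \<in> C\<close> unfolding \<T>_def pairwise_def disjnt_def by blast
  qed (use that in auto)
  define H where "H = (\<lambda>(s, x). h (comp x) (s, x))"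
  have H: "H (s, x) = h C (s, x)" if "C \<in> \<T>" "x \<in> C" for s x C
    using comp[OF that] by (simp add: H_def)
  have cont: "continuous_on (\<Union>C\<in>\<T>. {0..1::real} \<times> C) H"
  proof (rule continuous_on_closed_Union[OF fin'])
    fix C assume C: "C \<in> \<T>"
    then show "closed ({0..1::real} \<times> C)"
      using sets by (intro closed_Times) (auto simp: \<T>_def intro: compact_imp_closed)
    have "continuous_on ({0..1} \<times> C) (h C)" using ha C by blast
    then show "continuous_on ({0..1} \<times> C) H"
      by (rule continuous_on_eq) (use H[OF C] in auto)
  qed
  obtain C0 where C0: "C0 \<in> \<T>" using ne U by blast
  show ?thesis
    unfolding contracts_to_few_def U
  proof (intro exI conjI ballI)
    show "finite (a ` \<T>)" using fin' by simp
    have "card (a ` \<T>) \<le> card \<T>" using fin' by (rule card_image_le)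
    also have "\<dots> \<le> card \<S>" using fin by (intro card_mono) (auto simp: \<T>_def)
    finally show "card (a ` \<T>) \<le> r" using card by simp
    show "a ` \<T> \<subseteq> \<Union>\<T>" using ha by blast
    show "a C0 \<in> a ` \<T>" using C0 by blast
    have "{0..1::real} \<times> \<Union>\<T> = (\<Union>C\<in>\<T>. {0..1} \<times> C)" by auto
    then show "continuous_on ({0..1::real} \<times> \<Union>\<T>) H" using cont by simp
    show "H ` ({0..1} \<times> \<Union>\<T>) \<subseteq> \<Union>\<T>"
    proof clarify
      fix s :: real and x C assume s: "s \<in> {0..1}" and C: "C \<in> \<T>" "x \<in> C"
      have "h C ` ({0..1} \<times> C) \<subseteq> C" using ha C(1) by simp
      then have "h C (s, x) \<in> C" using s C(2) by (simp add: image_subset_iff)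
      then show "H (s, x) \<in> \<Union>\<T>" using H[OF C] C(1) by auto
    qed
    fix x assume "x \<in> \<Union>\<T>"
    then obtain C where C: "C \<in> \<T>" "x \<in> C" by blast
    show "H (0, x) = x" using H[OF C] ha C by simp
    show "H (1, x) \<in> a ` \<T>" using H[OF C] ha C by simp
  qed
qed

text \<open>If the full intersection were empty, the measures filling the simplex would realise
  every target by \<open>r\<close> atoms, against the parameter count.\<close>

theorem Inter_nonempty_of_contracts_to_few:
  fixes G :: "nat \<Rightarrow> 'a::euclidean_space set" and r n :: nat
  assumes r: "0 < r" and n: "r * (DIM('a) + 1) \<le> n"
    and G: "\<And>J. \<lbrakk>J \<subset> {..n}; J \<noteq> {}\<rbrakk> \<Longrightarrow> compact (\<Inter>i\<in>J. G i) \<and> contracts_to_few r (\<Inter>i\<in>J. G i)"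
  shows "(\<Inter>i\<le>n. G i) \<noteq> {}"
proof
  assume empty: "(\<Inter>i\<le>n. G i) = {}"
  have "0 < n" using r n by (cases n) auto
  have comp: "compact (G i)" and Gne: "G i \<noteq> {}" if "i \<le> n" for i
  proof -
    have "card {i} \<noteq> card {..n}" using \<open>0 < n\<close> by simp
    then have "{i} \<noteq> {..n}" by metis
    then have "{i} \<subset> {..n}" using that by (simp add: psubset_eq)
    then have "compact (G i) \<and> contracts_to_few r (G i)" using G[of "{i}"] by simp
    then show "compact (G i)" "G i \<noteq> {}" by (auto simp: contracts_to_few_def)
  qed
  have "bounded (\<Union>i\<le>n. G i)" using comp by (intro bounded_UN) (auto intro: compact_imp_bounded)
  then obtain b where b: "\<And>x i. \<lbrakk>i \<le> n; x \<in> G i\<rbrakk> \<Longrightarrow> norm x \<le> b"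
    unfolding bounded_iff by blast
  obtain R :: nat where "b \<le> R" using real_arch_simple by blast
  then have R: "G i \<subseteq> cball 0 R" if "i \<le> n" for i using b[OF that] by force
  \<comment> \<open>The region allowed for measures over the face \<open>\<sigma>\<close>. The ball
    supplies a compact contractible region for the full face, where the intersection is over no
    index; for smaller faces it changes nothing.\<close>
  define D where "D = (\<lambda>\<sigma>. cball 0 (real R) \<inter> (\<Inter>i\<in>{..n} - \<sigma>. G i))"
  have D_all: "D {..n} = cball 0 R" by (simp add: D_def)
  have contr: "compact (D \<sigma>) \<and> contracts_to_few r (D \<sigma>)" if "\<sigma> \<subseteq> {..n}" "\<sigma> \<noteq> {}" for \<sigma>
  proof (cases "\<sigma> = {..n}")
    case True
    have "contracts_to_few r (\<Union>{cball (0::'a) R})"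
      using r by (intro contracts_to_few_Union) (auto intro: convex_imp_contractible)
    then show ?thesis using True D_all by simp
  next
    case False
    then have ne: "{..n} - \<sigma> \<noteq> {}" using that(1) by auto
    then obtain i where i: "i \<in> {..n} - \<sigma>" by (meson ex_in_conv)
    then have "(\<Inter>j\<in>{..n} - \<sigma>. G j) \<subseteq> G i" by (rule INF_lower)
    then have "(\<Inter>j\<in>{..n} - \<sigma>. G j) \<subseteq> cball 0 R" using R[of i] i by auto
    then have "D \<sigma> = (\<Inter>i\<in>{..n} - \<sigma>. G i)" unfolding D_def by (rule Int_absorb1)
    moreover have "{..n} - \<sigma> \<subset> {..n}" using that by auto
    ultimately show ?thesis using G[OF _ ne] by simp
  qed
  have "D \<tau> \<subseteq> D \<sigma>" if "\<tau> \<subseteq> \<sigma>" for \<sigma> \<tau> using that unfolding D_def by blast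
  then have "\<exists>M. \<forall>\<sigma>\<subseteq>{..n}. (\<forall>z\<in>std_face \<sigma>. atomic r (D \<sigma>) (M z)) \<and>
    (\<forall>\<phi>. continuous_on (D \<sigma>) \<phi> \<longrightarrow> continuous_on (std_face \<sigma>) (\<lambda>z. M z \<phi>))"
    by (intro atomic_family_on_simplex contr) auto
  then obtain M where M0: "\<forall>\<sigma>\<subseteq>{..n}. (\<forall>z\<in>std_face \<sigma>. atomic r (D \<sigma>) (M z)) \<and>
    (\<forall>\<phi>. continuous_on (D \<sigma>) \<phi> \<longrightarrow> continuous_on (std_face \<sigma>) (\<lambda>z. M z \<phi>))"
    by (rule exE)
  have M: "atomic r (D \<sigma>) (M z)" if "\<sigma> \<subseteq> {..n}" "z \<in> std_face \<sigma>" for \<sigma> z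
    using M0[rule_format, of \<sigma>] that by simp
  have contM: "continuous_on (std_face {..n}) (\<lambda>z. M z \<phi>)" if "continuous_on (cball 0 R) \<phi>" for \<phi>
    using M0[rule_format, of "{..n}"] that D_all by simp

  \<comment> \<open>As no point lies in all \<open>G j\<close>, the sum of distances is positive,
    and the quotients form a partition of unity whose \<open>i\<close>-th member vanishes on
    \<open>G i\<close>.\<close>
  define Q where "Q = (\<lambda>x. \<Sum>j\<le>n. infdist x (G j))"
  define \<phi> where "\<phi> = (\<lambda>i x. infdist x (G i) / Q x)"
  have Q_pos: "0 < Q x" for x
  proof -
    obtain j where j: "j \<le> n" "x \<notin> G j" using empty by blast
    have "0 < infdist x (G j)"
      using j comp Gne by (intro infdist_pos_not_in_closed) (auto intro: compact_imp_closed)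
    also have "\<dots> \<le> Q x" unfolding Q_def using j by (intro member_le_sum) (auto simp: infdist_nonneg)
    finally show ?thesis .
  qed
  have cont_Q: "continuous_on S Q" for S
    unfolding Q_def by (intro continuous_intros)
  have cont_\<phi>: "continuous_on S (\<phi> i)" for S i
    unfolding \<phi>_def by (intro continuous_intros cont_Q) (use Q_pos in \<open>auto simp: less_imp_neq[symmetric]\<close>)
  have \<phi>0: "0 \<le> \<phi> i x" for i x using Q_pos[of x] by (simp add: \<phi>_def infdist_nonneg)
  have \<phi>1: "(\<Sum>i\<le>n. \<phi> i x) = 1" for x
    using Q_pos[of x] unfolding \<phi>_def sum_divide_distrib[symmetric] by (simp add: Q_def)
  have \<phi>_le: "\<phi> i x \<le> 1" if "i \<le> n" for i x
    unfolding \<phi>1[symmetric, of x] using that \<phi>0 by (intro member_le_sum) auto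
  obtain x0 where "x0 \<in> cball (0::'a) R" and x0: "\<And>x. x \<in> cball 0 R \<Longrightarrow> Q x0 \<le> Q x"
    using continuous_attains_inf[OF compact_cball _ cont_Q, of 0 "real R"] by auto
  \<comment> \<open>The minimum of \<open>Q\<close> on the compact ball: a uniform lower bound for
    the denominators, hence a Lipschitz constant.\<close>
  define \<delta> where "\<delta> = Q x0"
  have \<delta>: "0 < \<delta>" using Q_pos by (simp add: \<delta>_def)
  have inf_lip: "\<bar>infdist x A - infdist y A\<bar> \<le> dist x y" for x y :: 'a and A
    using infdist_triangle[of x A y] infdist_triangle[of y A x] by (simp add: dist_commute abs_le_iff)
  have Q_lip: "\<bar>Q x - Q y\<bar> \<le> Suc n * dist x y" for x y
  proof -
    have "\<bar>Q x - Q y\<bar> \<le> (\<Sum>j\<le>n. \<bar>infdist x (G j) - infdist y (G j)\<bar>)"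
      unfolding Q_def sum_subtractf[symmetric] by (rule sum_abs)
    also have "\<dots> \<le> (\<Sum>j\<le>n. dist x y)" by (intro sum_mono inf_lip)
    finally show ?thesis by simp
  qed
  have lip: "\<bar>\<phi> i x - \<phi> i y\<bar> \<le> (Suc n + 1) / \<delta> * dist x y"
    if i: "i \<le> n" and x: "x \<in> cball 0 R" for i x y
  proof -
    have "\<phi> i x - \<phi> i y = ((infdist x (G i) - infdist y (G i)) + \<phi> i y * (Q y - Q x)) / Q x"
      using Q_pos[of x] Q_pos[of y] by (simp add: \<phi>_def field_simps)
    then have "\<bar>\<phi> i x - \<phi> i y\<bar> = \<bar>(infdist x (G i) - infdist y (G i)) + \<phi> i y * (Q y - Q x)\<bar> / Q x"
      using Q_pos[of x] by (simp add: abs_divide)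
    also have "\<dots> \<le> (dist x y + 1 * (Suc n * dist x y)) / Q x"
    proof (intro divide_right_mono order_trans[OF abs_triangle_ineq] add_mono inf_lip)
      show "\<bar>\<phi> i y * (Q y - Q x)\<bar> \<le> 1 * (Suc n * dist x y)"
        unfolding abs_mult using Q_lip[of y x] \<phi>0[of i y] \<phi>_le[OF i, of y]
        by (intro mult_mono) (auto simp: dist_commute)
    qed (use Q_pos[of x] in simp)
    also have "\<dots> \<le> (dist x y + 1 * (Suc n * dist x y)) / \<delta>"
      using x0[OF x] \<delta> by (intro divide_left_mono) (auto simp: \<delta>_def Q_pos intro!: add_nonneg_nonneg)
    also have "\<dots> = (Suc n + 1) / \<delta> * dist x y" by (simp add: field_simps)
    finally show ?thesis .
  qed
  obtain w where w: "\<forall>i<n. 0 \<le> w i" "(\<Sum>i<n. w i) < 1"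
    and no: "\<not> (\<exists>t x. (\<forall>k<r. 0 \<le> t k \<and> x k \<in> cball 0 R) \<and> (\<Sum>k<r. t k) = 1 \<and>
        (\<forall>i<n. (\<Sum>k<r. t k * \<phi> i (x k)) = w i))"
    using few_atoms_not_onto[OF r n, of R \<phi> "(Suc n + 1) / \<delta>"] lip \<phi>0 \<phi>_le by auto
  have "\<exists>z\<in>std_face {..n}. \<forall>i<n. M z (\<phi> i) = w i"
  proof (rule face_preserving_onto_simplex)
    fix z assume z: "z \<in> std_face {..n}"
    obtain t x where tx: "\<forall>k<r. 0 \<le> t k \<and> x k \<in> D {..n}" "(\<Sum>k<r. t k) = 1"
        "\<forall>\<phi>. M z \<phi> = (\<Sum>k<r. t k * \<phi> (x k))"
      using atomic_indexed[OF M[OF order_refl z]] by (elim exE conjE) (rule that)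
    show "0 \<le> M z (\<phi> i)" for i
      unfolding tx(3)[rule_format] using tx(1) \<phi>0 by (intro sum_nonneg) auto
    have "(\<Sum>i\<le>n. M z (\<phi> i)) = (\<Sum>k<r. t k * (\<Sum>i\<le>n. \<phi> i (x k)))"
      unfolding tx(3)[rule_format] sum_distrib_left by (rule sum.swap)
    then show "(\<Sum>i\<le>n. M z (\<phi> i)) = 1" using tx(2) by (simp add: \<phi>1)
    fix i assume i: "i \<le> n" "z i = 0"
    \<comment> \<open>\<open>z i = 0\<close> places \<open>z\<close> in the facet opposite
      \<open>i\<close>, so its measure lives on \<open>G i\<close>, where \<open>\<phi> i\<close> is
      0.\<close>
    have at: "atomic r (D ({..n} - {i})) (M z)" by (intro M std_face_remove z i) auto
    have "M z (\<phi> i) = M z (\<lambda>_. 0)"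
    proof (rule atomic_cong[OF at])
      fix x assume "x \<in> D ({..n} - {i})"
      then have "x \<in> G i" using i by (auto simp: D_def)
      then show "\<phi> i x = 0" by (simp add: \<phi>_def)
    qed
    then show "M z (\<phi> i) = 0" by (simp add: tx(3))
  qed (use w contM cont_\<phi> in auto)
  then obtain z where z: "z \<in> std_face {..n}" "\<And>i. i < n \<Longrightarrow> M z (\<phi> i) = w i" by blast
  obtain t x where tx: "\<forall>k<r. 0 \<le> t k \<and> x k \<in> D {..n}" "(\<Sum>k<r. t k) = 1"
      "\<forall>\<phi>. M z \<phi> = (\<Sum>k<r. t k * \<phi> (x k))"
    using atomic_indexed[OF M[OF order_refl z(1)]] by (elim exE conjE) (rule that)
  have "\<forall>i<n. (\<Sum>k<r. t k * \<phi> i (x k)) = w i" using z(2) tx(3) by simp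
  then show False using no tx(1,2) unfolding D_all by blast
qed

text \<open>The first conjunct ensures that the \<open>LEAST\<close> defining
  \<open>helly_number\<close> is attained. The bound comes from a subfamily of least cardinality
  with empty intersection.\<close>

theorem theorem1p3:
  fixes \<F> \<G> :: "'a::euclidean_space set set" and r :: nat
  assumes "good_cover \<F>" and "r \<ge> 1" and "Fr_family \<F> r \<G>"
  shows "(\<exists>h>0. helly_prop \<G> h) \<and> helly_number \<G> \<le> r * (DIM('a) + 1)"
proof -
  define h where "h = r * (DIM('a) + 1)"
  have h_pos: "0 < h" using assms(2) by (simp add: h_def)
  have "helly_prop \<G> h"
    unfolding helly_prop_def
  proof (intro allI impI notI)
    fix \<K> :: "'a set set"
    assume \<K>: "finite \<K> \<and> \<K> \<subseteq> \<G> \<and> (\<forall>\<K>'\<subseteq>\<K>. card \<K>' \<le> h \<longrightarrow> \<Inter>\<K>' \<noteq> {})" and "\<Inter>\<K> = {}"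
    \<comment> \<open>Least cardinality makes every proper subfamily of \<open>\<L>\<close>
      intersect, while the hypothesis on \<open>\<K>\<close> forces \<open>\<L>\<close> to have more
      than \<open>h\<close> members.\<close>
    then have "\<K> \<subseteq> \<K> \<and> \<Inter>\<K> = {}" by simp
    from ex_has_least_nat[of "\<lambda>\<L>. \<L> \<subseteq> \<K> \<and> \<Inter>\<L> = {}", OF this, of card]
    obtain \<L> where \<L>: "\<L> \<subseteq> \<K>" "\<Inter>\<L> = {}"
      and least: "\<forall>\<L>'. \<L>' \<subseteq> \<K> \<and> \<Inter>\<L>' = {} \<longrightarrow> card \<L> \<le> card \<L>'"
      by (elim exE conjE) (rule that)
    have fin: "finite \<L>" using \<L> \<K> finite_subset by blast
    have "h < card \<L>" using \<K>[THEN conjunct2, THEN conjunct2, rule_format, of \<L>] \<L> by (meson not_le)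
    then obtain n where n: "card \<L> = Suc n" "h \<le> n" by (cases "card \<L>") auto
    obtain f where "bij_betw f {0..<card \<L>} \<L>" using ex_bij_betw_nat_finite[OF fin] by blast
    then have f: "bij_betw f {..n} \<L>"
      by (simp add: n atLeast0LessThan lessThan_Suc_atMost)
    have "(\<Inter>i\<le>n. f i) \<noteq> {}"
    proof (rule Inter_nonempty_of_contracts_to_few)
      show "0 < r" "r * (DIM('a) + 1) \<le> n" using assms(2) n(2) by (auto simp: h_def)
      fix J assume J: "J \<subset> {..n}" "J \<noteq> {}"
      have finJ: "finite J" using J(1) finite_subset by blast
      have sub: "f ` J \<subseteq> \<L>" using f J(1) by (auto simp: bij_betw_def)
      have "card (f ` J) \<le> card J" using finJ by (rule card_image_le)
      also have "\<dots> < card \<L>" using psubset_card_mono[OF _ J(1)] n(1) by simp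
      finally have "card (f ` J) < card \<L>" .
      then have ne: "\<Inter>(f ` J) \<noteq> {}" using least[rule_format, of "f ` J"] sub \<L>(1) by auto
      have "f ` J \<subseteq> \<G>" using sub \<L>(1) \<K> by blast
      then obtain \<S> where \<S>: "\<S> \<subseteq> \<F>" "card \<S> \<le> r" "disjoint \<S>" "\<Inter>(f ` J) = \<Union>\<S>"
        using assms(3) finJ J(2) unfolding Fr_family_def by (metis finite_imageI image_is_empty)
      have finS: "finite \<S>" using \<S>(1) assms(1) finite_subset unfolding good_cover_def by blast
      have sets: "compact C \<and> contractible C" if "C \<in> \<S>" for C
      proof -
        have "C \<in> \<F>" using that \<S>(1) by blast
        \<comment> \<open>The singleton subfamily yields contractibility of \<open>C\<close> itself;
          an empty \<open>C\<close> also counts as contractible.\<close>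
        then have "compact C" "\<Inter>{C} = {} \<or> contractible (\<Inter>{C})"
          using assms(1) unfolding good_cover_def by blast+
        then show ?thesis by auto
      qed
      have "compact (\<Union>\<S>)" using finS sets by (intro compact_Union) auto
      moreover have "contracts_to_few r (\<Union>\<S>)"
        using ne unfolding \<S>(4) by (intro contracts_to_few_Union finS \<S> sets)
      ultimately show "compact (\<Inter>i\<in>J. f i) \<and> contracts_to_few r (\<Inter>i\<in>J. f i)"
        using \<S>(4) by simp
    qed
    moreover have "(\<Inter>i\<le>n. f i) = \<Inter>\<L>" using f by (simp add: bij_betw_def)
    ultimately show False using \<L>(2) by simp
  qed
  then show ?thesis
    using h_pos unfolding helly_number_def h_def[symmetric] by (blast intro: Least_le)
qed

end
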